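(* Let $m<-1$. For every $a\in\mathbb{R}$, the boundary value problem $$f'''+\frac{m+1}{2}ff''-mf'^2=0 \text{ on } [0,\infty),\qquad f(0)=a,\quad f'(0)=-1,\quad f'(\infty)=0$$ has a unique convex solution. Moreover, this solution is bounded, and if $\lim_{t\to\infty}f(t)=\ell$, then $$-\sqrt{a^2-\frac{4}{m+1}}<\ell<a.$$
   Context: A solution is a three times differentiable function $f:[0,\infty)\to\mathbb{R}$ satisfying the equation on $[0,\infty)$ and the boundary conditions, where $f'(\infty):=\lim_{t\to\infty}f'(t)$. A convex solution is a solution that is convex on all of $[0,\infty)$. *)

theory Defs
  imports "HOL-Analysis.Analysis"
begin

text \<open>
  Derivatives are taken within \<open>{0..}\<close>, so they are one-sided at the endpoint \<open>0\<close>, and the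
  values of \<open>f\<close> at negative arguments are irrelevant. The witnesses \<open>f1\<close>, \<open>f2\<close>, \<open>f3\<close> are
  determined by \<open>f\<close> on \<open>{0..}\<close>.
\<close>

definition bvp_solution :: "real \<Rightarrow> real \<Rightarrow> (real \<Rightarrow> real) \<Rightarrow> bool" where
  "bvp_solution m a f \<longleftrightarrow>
     (\<exists>f1 f2 f3.
        (\<forall>t\<ge>0. (f has_real_derivative f1 t) (at t within {0..})) \<and>
        (\<forall>t\<ge>0. (f1 has_real_derivative f2 t) (at t within {0..})) \<and>
        (\<forall>t\<ge>0. (f2 has_real_derivative f3 t) (at t within {0..})) \<and>
        (\<forall>t\<ge>0. f3 t + (m + 1) / 2 * f t * f2 t - m * (f1 t)\<^sup>2 = 0) \<and>
        f 0 = a \<and> f1 0 = -1 \<and> (f1 \<longlongrightarrow> 0) at_top)"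

definition convex_bvp_solution :: "real \<Rightarrow> real \<Rightarrow> (real \<Rightarrow> real) \<Rightarrow> bool" where
  "convex_bvp_solution m a f \<longleftrightarrow> bvp_solution m a f \<and> convex_on {0..} f"

end

(*
  Put b = -(m + 1) / 2 > 0, so that the equation reads f''' = b f f'' - (1 + 2 b) f'^2.

  Existence is by shooting on c = f''(0). After clamping f, f', f'' to bounded ranges the system has
  a global flow depending continuously on c. The set of c for which f' becomes positive and the set
  of c for which f'' becomes negative are open, disjoint and nonempty, so by connectedness some c
  lies in neither; there f' <= 0 <= f'' throughout, and a priori bounds show that no clamp is active.

  Uniqueness: if two convex solutions start with different f''(0), compare them at times where
  their first derivatives agree. The difference of the second derivatives cannot decrease, hence
  one of them has f'' bounded below by a positive constant, which is impossible as f' < 0.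

  Limit: f'' - b f f' is strictly decreasing with nonnegative limit, hence positive; integrating it
  gives 1 + b (a^2 - l^2) / 2 > 0.
*)

theory Submission
  imports Defs
begin

subsection \<open>One-sided differentiability on the half-line\<close>

text \<open>The clamps do more than bound the vector field. Cutting \<open>z\<close> below at
  \<open>0\<close> and \<open>y\<close> above at \<open>0\<close> makes the two failures of a shot
  mutually exclusive: once \<open>z < 0\<close> the linear term vanishes and \<open>z\<close> cannot
  recover, and once \<open>y > 0\<close> the square vanishes and a positive \<open>z\<close> decays
  at most exponentially. The constants are fixed without circularity: \<open>\<Lambda>\<close> from
  \<open>a\<close> and \<open>b\<close>, then the overshooting slope \<open>C\<close> from
  \<open>\<Lambda>\<close>, then \<open>R\<close> from \<open>C\<close>, so that one flow serves all
  \<open>c\<close> in \<open>{0..C}\<close>. In the uniqueness proof, a comparison at equal times is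
  obstructed by \<open>f\<close>, which may become negative: it is the coefficient of the difference
  of the second derivatives, and the gap could decay. With \<open>v = f'\<close> as independent
  variable and \<open>w = f''\<close>, the equation becomes \<open>df/dv = v / w\<close> and
  \<open>dw/dv = b f - (1 + 2 b) v^2 / w\<close>. For \<open>v < 0\<close> and \<open>w > 0\<close>
  the first right-hand side increases with \<open>w\<close>, the second with \<open>f\<close> and
  with \<open>w\<close>, so an initial gap in \<open>w\<close> cannot shrink.\<close>

lemma has_real_derivative_at_of_within:
  assumes "(g has_real_derivative D) (at t within {0..})" "0 < (t::real)"
  shows "(g has_real_derivative D) (at t)"
proof -
  have "at t within {0..} = at t"
    by (rule at_within_interior) (use assms(2) in simp)
  then show ?thesis using assms(1) by simp
qed

lemma continuous_on_of_within_derivative: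
  assumes "\<forall>t\<ge>0. (g has_real_derivative g' t) (at t within {0..})" and "S \<subseteq> {0..}"
  shows "continuous_on S g"
proof -
  have "continuous_on {0..} g"
    unfolding continuous_on_eq_continuous_within using assms(1) by (simp add: DERIV_continuous[OF assms(1)[rule_format]])
  then show ?thesis using assms(2) by (rule continuous_on_subset)
qed

lemma nondecreasing_of_within_derivative:
  fixes g :: "real \<Rightarrow> real"
  assumes "\<forall>t\<ge>0. (g has_real_derivative g' t) (at t within {0..})"
    and "0 \<le> p" "p \<le> t" and "\<And>u. p < u \<Longrightarrow> u < t \<Longrightarrow> g' u \<ge> 0"
  shows "g p \<le> g t"
proof (rule DERIV_nonneg_imp_increasing_open[OF assms(3)])
  fix x assume x: "p < x" "x < t"
  then have "(g has_real_derivative g' x) (at x)"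
    using assms(1,2) by (intro has_real_derivative_at_of_within) auto
  then show "\<exists>y. (g has_real_derivative y) (at x) \<and> 0 \<le> y"
    using assms(4) x by blast
next
  show "continuous_on {p..t} g"
    using assms(2) by (intro continuous_on_of_within_derivative[OF assms(1)]) auto
qed

lemma mvt_of_within_derivative:
  fixes g :: "real \<Rightarrow> real"
  assumes "\<forall>t\<ge>0. (g has_real_derivative g' t) (at t within {0..})"
    and "0 \<le> p" "p < t"
  obtains u where "p < u" "u < t" "g t - g p = (t - p) * g' u"
proof -
  have c: "continuous_on {p..t} g"
    using assms(2) by (intro continuous_on_of_within_derivative[OF assms(1)]) auto
  have d: "(g has_real_derivative g' u) (at u)" if "p < u" for u
    using assms(1,2) that by (intro has_real_derivative_at_of_within) auto
  obtain l u where u: "p < u" "u < t" "(g has_real_derivative l) (at u)" "g t - g p = (t - p) * l"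
    using MVT[OF assms(3) c] d unfolding real_differentiable_def by metis
  have "l = g' u" by (rule DERIV_unique[OF u(3) d[OF u(1)]])
  then show ?thesis using that[OF u(1,2)] u(4) by simp
qed

text \<open>The differential inequality is only required as long as \<open>g\<close> has stayed nonnegative:
  by the resulting lower bound, \<open>g\<close> never reaches its first zero.\<close>

lemma positivity_barrier:
  fixes g :: "real \<Rightarrow> real"
  assumes pt: "p \<le> t" and cont: "continuous_on {p..t} g"
    and der: "\<And>u. p < u \<Longrightarrow> u < t \<Longrightarrow> (g has_real_derivative g' u) (at u)"
    and ineq: "\<And>u. p < u \<Longrightarrow> u < t \<Longrightarrow> (\<And>w. p \<le> w \<Longrightarrow> w \<le> u \<Longrightarrow> g w \<ge> 0) \<Longrightarrow> g' u \<ge> - K * g u"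
    and gp: "g p > 0"
  shows "g t \<ge> g p * exp (- K * (t - p))"
proof -
  \<comment> \<open>The integrating factor is \<open>exp (K * u)\<close>. Nonnegativity is assumed
    only strictly before \<open>q\<close>, so that \<open>q\<close> may be the first point with
    \<open>g q \<le> 0\<close> in the compactness argument below.\<close>
  have step: "g q \<ge> g p * exp (- K * (q - p))"
    if q: "p \<le> q" "q \<le> t" and nn: "\<And>w. p \<le> w \<Longrightarrow> w < q \<Longrightarrow> g w \<ge> 0" for q
  proof -
    have "exp (K * p) * g p \<le> exp (K * q) * g q"
    proof (rule DERIV_nonneg_imp_increasing_open[OF q(1)])
      fix x assume x: "p < x" "x < q"
      have "((\<lambda>u. exp (K * u) * g u) has_real_derivative exp (K * x) * (g' x + K * g x)) (at x)"
        using der[of x] x q by (auto intro!: derivative_eq_intros simp: algebra_simps)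
      moreover have "g' x + K * g x \<ge> 0" using ineq[of x] x q nn by force
      ultimately show "\<exists>y. ((\<lambda>u. exp (K * u) * g u) has_real_derivative y) (at x) \<and> 0 \<le> y"
        by (intro exI[of _ "exp (K * x) * (g' x + K * g x)"] conjI mult_nonneg_nonneg) auto
    next
      show "continuous_on {p..q} (\<lambda>u. exp (K * u) * g u)"
        using cont q by (intro continuous_intros) (auto intro: continuous_on_subset)
    qed
    then have "exp (- (K * q)) * (exp (K * p) * g p) \<le> exp (- (K * q)) * (exp (K * q) * g q)"
      by (rule mult_left_mono) simp
    also have "\<dots> = g q" by (simp add: exp_minus)
    also have "exp (- (K * q)) * (exp (K * p) * g p) = g p * exp (- K * (q - p))"
    proof -
      have "exp (- K * (q - p)) = exp (- (K * q)) * exp (K * p)"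
        by (simp add: exp_add [symmetric] algebra_simps)
      then show ?thesis by simp
    qed
    finally show ?thesis .
  qed
  have "\<forall>w\<in>{p..t}. g w > 0"
  proof (rule ccontr)
    assume "\<not> (\<forall>w\<in>{p..t}. g w > 0)"
    then have ne: "{p..t} \<inter> g -` {..0} \<noteq> {}" by force
    have "closed ({p..t} \<inter> g -` {..0})"
      by (rule continuous_closed_preimage[OF cont]) auto
    then have "compact ({p..t} \<inter> g -` {..0})"
      using compact_Int_closed[OF compact_Icc, of "{p..t} \<inter> g -` {..0}" p t]
      by (simp add: Int_absorb1)
    then obtain q where q: "q \<in> {p..t} \<inter> g -` {..0}"
      and min: "\<And>w. w \<in> {p..t} \<inter> g -` {..0} \<Longrightarrow> q \<le> w"
      using compact_attains_inf[OF _ ne] by blast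
    have "g w \<ge> 0" if "p \<le> w" "w < q" for w
      using min[of w] that q by force
    then have "g q \<ge> g p * exp (- K * (q - p))" using step q by auto
    moreover have "g p * exp (- K * (q - p)) > 0" using gp by simp
    ultimately show False using q by auto
  qed
  then show ?thesis using step[of t] pt by (simp add: less_imp_le)
qed

subsection \<open>Global flows of Lipschitz vector fields\<close>

lemma integral_has_vector_derivative_atLeast:
  fixes h :: "real \<Rightarrow> 'a::banach"
  assumes h: "continuous_on {0..} h" and t: "t \<ge> 0"
  shows "((\<lambda>u. integral {0..u} h) has_vector_derivative h t) (at t within {0..})"
proof -
  \<comment> \<open>The end \<open>t + 1\<close> keeps \<open>t\<close> away from the right
    boundary, so both within-filters agree at \<open>t\<close>.\<close>
  have "((\<lambda>u. integral {0..u} h) has_vector_derivative h t) (at t within {0..t + 1})"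
    using t by (intro integral_has_vector_derivative continuous_on_subset[OF h]) auto
  moreover have "at t within {0..t + 1} = at t within {0..}"
    by (rule at_within_nhd[of _ "{..<t + 1}"]) (use t in auto)
  ultimately show ?thesis by simp
qed

lemma integral_exp_le:
  fixes K :: real
  assumes "K > 0" "u \<ge> 0" "c \<ge> 0"
  shows "integral {0..u} (\<lambda>s. c * exp (K * s)) \<le> c / K * exp (K * u)"
    and "(\<lambda>s. c * exp (K * s)) integrable_on {0..u}"
proof -
  have *: "((\<lambda>s. c * exp (K * s)) has_integral c / K * exp (K * u) - c / K * exp (K * 0)) {0..u}"
    by (rule fundamental_theorem_of_calculus[OF assms(2)])
       (use assms in \<open>auto intro!: derivative_eq_intros simp: has_real_derivative_iff_has_vector_derivative [symmetric]\<close>)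
  then show "(\<lambda>s. c * exp (K * s)) integrable_on {0..u}" by blast
  have "0 \<le> c / K * exp (K * 0)" using assms by simp
  then show "integral {0..u} (\<lambda>s. c * exp (K * s)) \<le> c / K * exp (K * u)"
    using integral_unique[OF *] by linarith
qed

text \<open>The integral equation is a contraction for the weighted norm
  \<open>sup \<bar>exp (-2 L t) x t\<bar>\<close>, which gives a solution on all of \<open>{0..}\<close> in one step.\<close>

lemma lipschitz_flow:
  fixes g :: "'a::banach \<Rightarrow> 'a"
  assumes lip: "\<And>x y. norm (g x - g y) \<le> L * norm (x - y)" and L: "L > 0"
    and bnd: "\<And>x. norm (g x) \<le> B"
  obtains X where "\<And>x. X x 0 = x"
    and "\<And>x t. t \<ge> 0 \<Longrightarrow> (X x has_vector_derivative g (X x t)) (at t within {0..})"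
    and "\<And>x y t. t \<ge> 0 \<Longrightarrow> norm (X x t - X y t) \<le> 2 * exp (2 * L * t) * norm (x - y)"
proof -
  \<comment> \<open>With weight \<open>exp (- K * t)\<close> the integral operator has Lipschitz
    constant \<open>L / K\<close>, here \<open>1 / 2\<close>.\<close>
  define K where "K = 2 * L"
  have K: "K > 0" using L by (simp add: K_def)
  have "L-lipschitz_on UNIV g"
    using lip L by (intro lipschitz_onI) (auto simp: dist_norm)
  then have gc: "continuous_on UNIV g"
    by (rule lipschitz_on_continuous_on)
  define h where "h y s = g (exp (K * s) *\<^sub>R apply_bcontfun y s)" for y s
  define I where "I y u = integral {0..u} (h y)" for y u
  \<comment> \<open>The unknown \<open>y\<close> is the solution already multiplied by the weight.
    Replacing \<open>t\<close> by \<open>max 0 t\<close> extends it constantly to negative times, so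
    that it lives in the complete space of bounded continuous functions on the whole line.\<close>
  define P where "P x y t = exp (- (K * max 0 t)) *\<^sub>R (x + I y (max 0 t))" for x y and t :: real
  have hc: "continuous_on S (h y)" for S y
  proof -
    have "continuous_on S (\<lambda>s. exp (K * s) *\<^sub>R apply_bcontfun y s)"
      by (intro continuous_intros) auto
    then show ?thesis unfolding h_def
      by (rule continuous_on_compose2[OF gc]) auto
  qed
  have Id: "(I y has_vector_derivative h y t) (at t within {0..})" if "t \<ge> 0" for y t
    unfolding I_def[abs_def] using integral_has_vector_derivative_atLeast[OF hc that] .
  have Ic: "continuous_on {0..} (I y)" for y
    by (rule continuous_on_vector_derivative) (use Id in auto)
  have Ib: "norm (I y u) \<le> B * u" if "u \<ge> 0" for y u
    unfolding I_def using integral_bound[OF that hc, of y B] bnd by (simp add: h_def)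
  have B0: "B \<ge> 0" using bnd[of 0] norm_ge_zero order_trans by blast
  have Ilip: "norm (I y u - I z u) \<le> exp (K * u) * (dist y z / 2)" if "u \<ge> 0" for y z u
  proof -
    have "norm (integral {0..u} (\<lambda>s. h y s - h z s)) \<le> integral {0..u} (\<lambda>s. (L * dist y z) * exp (K * s))"
    proof (rule integral_norm_bound_integral)
      show "(\<lambda>s. h y s - h z s) integrable_on {0..u}"
        by (intro integrable_continuous_real continuous_on_diff hc)
      show "(\<lambda>s. (L * dist y z) * exp (K * s)) integrable_on {0..u}"
        using L that K by (intro integral_exp_le) auto
      fix s
      have "norm (h y s - h z s) \<le> L * norm (exp (K * s) *\<^sub>R apply_bcontfun y s - exp (K * s) *\<^sub>R apply_bcontfun z s)"
        unfolding h_def by (rule lip)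
      also have "\<dots> = L * (exp (K * s) * dist (apply_bcontfun y s) (apply_bcontfun z s))"
        by (simp add: scaleR_diff_right [symmetric] dist_norm)
      also have "\<dots> \<le> L * (exp (K * s) * dist y z)"
        using L by (intro mult_left_mono dist_bounded) auto
      finally show "norm (h y s - h z s) \<le> L * dist y z * exp (K * s)"
        by (simp add: mult_ac)
    qed
    also have "\<dots> \<le> (L * dist y z) / K * exp (K * u)"
      using L that K by (intro integral_exp_le) auto
    also have "\<dots> = exp (K * u) * (dist y z / 2)" using L by (simp add: K_def)
    finally show ?thesis unfolding I_def
      by (subst integral_diff [symmetric]) (auto intro!: integrable_continuous_real hc)
  qed
  have Pb: "P x y \<in> bcontfun" for x y
  proof (rule bcontfun_normI)
    have "continuous_on UNIV (\<lambda>t. I y (max 0 t))"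
      by (rule continuous_on_compose2[OF Ic]) (auto intro!: continuous_intros)
    then show "continuous_on UNIV (P x y)"
      unfolding P_def[abs_def] by (intro continuous_intros)
  next
    fix t :: real
    define u where "u = max 0 t"
    have u: "u \<ge> 0" by (simp add: u_def)
    \<comment> \<open>The bound \<open>B\<close> on the field lets the integral grow only linearly,
      and the weight absorbs linear growth.\<close>
    have "K * u \<le> exp (K * u)" using exp_ge_add_one_self[of "K * u"] by linarith
    then have "exp (- (K * u)) * u \<le> 1 / K"
      using K by (simp add: exp_minus field_simps)
    then have 1: "exp (- (K * u)) * (B * u) \<le> B / K"
      using B0 mult_left_mono[of "exp (- (K * u)) * u" "1 / K" B] by (simp add: mult_ac)
    have 2: "exp (- (K * u)) * norm x \<le> 1 * norm x"
      using K u by (intro mult_right_mono) auto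
    have "norm (P x y t) = exp (- (K * u)) * norm (x + I y u)"
      by (simp add: P_def u_def)
    also have "\<dots> \<le> exp (- (K * u)) * (norm x + B * u)"
      using norm_triangle_le[of x "I y u" "norm x + B * u"] Ib[OF u, of y] by (intro mult_left_mono) auto
    also have "\<dots> \<le> norm x + B / K"
      using 1 2 by (simp add: distrib_left)
    finally show "norm (P x y t) \<le> norm x + B / K" .
  qed
  define Q where "Q x y = Bcontfun (P x y)" for x y
  have Q: "apply_bcontfun (Q x y) = P x y" for x y
    unfolding Q_def using Pb by (simp add: Bcontfun_inverse)
  \<comment> \<open>This estimate serves twice: for \<open>x = x'\<close> it is the contraction
    property, and at two fixed points it gives Lipschitz dependence on the initial value.\<close>
  have Qlip: "dist (Q x y) (Q x' z) \<le> norm (x - x') + dist y z / 2" for x x' y z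
  proof (rule dist_bound)
    fix t :: real
    define u where "u = max 0 t"
    have u: "u \<ge> 0" by (simp add: u_def)
    have "dist (P x y t) (P x' z t) = exp (- (K * u)) * norm ((x - x') + (I y u - I z u))"
    proof -
      have "dist (P x y t) (P x' z t) = norm (exp (- (K * u)) *\<^sub>R ((x + I y u) - (x' + I z u)))"
        by (simp only: P_def u_def dist_norm scaleR_diff_right)
      then show ?thesis by (simp add: add_diff_add)
    qed
    also have "\<dots> \<le> exp (- (K * u)) * (norm (x - x') + exp (K * u) * (dist y z / 2))"
      using norm_triangle_le[of "x - x'" "I y u - I z u"] Ilip[OF u, of y z] by (intro mult_left_mono) auto
    also have "\<dots> = exp (- (K * u)) * norm (x - x') + dist y z / 2"
      by (simp add: distrib_left exp_minus)
    also have "\<dots> \<le> 1 * norm (x - x') + dist y z / 2"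
      using K u by (intro add_right_mono mult_right_mono) auto
    finally show "dist (apply_bcontfun (Q x y) t) (apply_bcontfun (Q x' z) t) \<le> norm (x - x') + dist y z / 2"
      by (simp add: Q)
  qed
  have "\<exists>!y. Q x y = y" for x
  proof (rule banach_fix_type)
    show "\<forall>y z. dist (Q x y) (Q x z) \<le> 1 / 2 * dist y z" using Qlip[of x _ x] by simp
  qed auto
  then obtain Y where Y: "\<And>x. Q x (Y x) = Y x" by metis
  define X where "X x t = x + I (Y x) t" for x t
  have XY: "X x t = exp (K * t) *\<^sub>R apply_bcontfun (Y x) t" if "t \<ge> 0" for x t
  proof -
    have "apply_bcontfun (Y x) t = P x (Y x) t" using Q[of x "Y x"] Y by simp
    then show ?thesis using that by (simp add: P_def X_def exp_minus)
  qed
  show ?thesis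
  proof
    show "X x 0 = x" for x by (simp add: X_def I_def)
    show "(X x has_vector_derivative g (X x t)) (at t within {0..})" if "t \<ge> 0" for x t
    proof -
      have "(X x has_vector_derivative 0 + h (Y x) t) (at t within {0..})"
        unfolding X_def[abs_def] by (intro has_vector_derivative_add has_vector_derivative_const Id that)
      then show ?thesis by (simp add: h_def XY[OF that])
    qed
    show "norm (X x t - X y t) \<le> 2 * exp (2 * L * t) * norm (x - y)" if "t \<ge> 0" for x y t
    proof -
      have "dist (Y x) (Y y) \<le> norm (x - y) + dist (Y x) (Y y) / 2"
        using Qlip[of x "Y x" y "Y y"] by (simp add: Y)
      then have d: "dist (Y x) (Y y) \<le> 2 * norm (x - y)" by simp
      have "norm (X x t - X y t) = exp (K * t) * dist (apply_bcontfun (Y x) t) (apply_bcontfun (Y y) t)"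
        by (simp add: XY[OF that] scaleR_diff_right [symmetric] dist_norm)
      also have "\<dots> \<le> exp (K * t) * (2 * norm (x - y))"
        using dist_bounded[of "Y x" t "Y y"] d by (intro mult_left_mono) auto
      finally show ?thesis by (simp add: K_def mult_ac)
    qed
  qed
qed

subsection \<open>The clamped system\<close>

definition clamp_real :: "real \<Rightarrow> real \<Rightarrow> real \<Rightarrow> real" where
  "clamp_real l u x = max l (min u x)"

lemma clamp_real_bounds: "l \<le> u \<Longrightarrow> l \<le> clamp_real l u x \<and> clamp_real l u x \<le> u"
  by (auto simp: clamp_real_def)

lemma clamp_real_eq: "l \<le> x \<Longrightarrow> x \<le> u \<Longrightarrow> clamp_real l u x = x"
  by (auto simp: clamp_real_def)

lemma clamp_real_lipschitz: "\<bar>clamp_real l u x - clamp_real l u y\<bar> \<le> \<bar>x - y\<bar>"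
  by (auto simp: clamp_real_def)

lemma abs_mult_diff_le:
  fixes x y x' y' :: real
  assumes "\<bar>y\<bar> \<le> N" "\<bar>x'\<bar> \<le> M" "\<bar>x - x'\<bar> \<le> d" "\<bar>y - y'\<bar> \<le> d"
  shows "\<bar>x * y - x' * y'\<bar> \<le> (M + N) * d"
proof -
  have "x * y - x' * y' = (x - x') * y + x' * (y - y')" by (simp add: algebra_simps)
  then have "\<bar>x * y - x' * y'\<bar> \<le> \<bar>x - x'\<bar> * \<bar>y\<bar> + \<bar>x'\<bar> * \<bar>y - y'\<bar>"
    by (metis abs_mult abs_triangle_ineq)
  also have "\<dots> \<le> d * N + M * d"
    using assms by (intro add_mono mult_mono) auto
  finally show ?thesis by (simp add: algebra_simps)
qed

text \<open>Clamping turns the quadratic system into a bounded, globally Lipschitz field, so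
  \<open>lipschitz_flow\<close> applies. Continuity in \<open>c\<close> at each fixed time is what
  makes the two failure sets of the shooting argument open.\<close>

lemma clamped_flow:
  fixes a b \<Lambda> R :: real
  assumes b: "b > 0" and \<Lambda>: "\<Lambda> > 0" and R: "R > 0"
  obtains x y z :: "real \<Rightarrow> real \<Rightarrow> real"
  where "\<And>c. \<forall>t\<ge>0. (x c has_real_derivative clamp_real (-1) 0 (y c t)) (at t within {0..})"
    and "\<And>c. \<forall>t\<ge>0. (y c has_real_derivative clamp_real 0 R (z c t)) (at t within {0..})"
    and "\<And>c. \<forall>t\<ge>0. (z c has_real_derivative
          b * clamp_real (-\<Lambda>) \<Lambda> (x c t) * clamp_real 0 R (z c t)
          - (1 + 2 * b) * (clamp_real (-1) 0 (y c t))\<^sup>2) (at t within {0..})"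
    and "\<And>c. x c 0 = a" "\<And>c. y c 0 = -1" "\<And>c. z c 0 = c"
    and "\<And>t. t \<ge> 0 \<Longrightarrow> continuous_on UNIV (\<lambda>c. y c t)"
    and "\<And>t. t \<ge> 0 \<Longrightarrow> continuous_on UNIV (\<lambda>c. z c t)"
proof -
  define h where "h x y z = b * (clamp_real (-\<Lambda>) \<Lambda> x * clamp_real 0 R z)
      - (1 + 2 * b) * (clamp_real (-1) 0 y * clamp_real (-1) 0 y)" for x y z
  define g where "g p = (clamp_real (-1) 0 (fst (snd p)), clamp_real 0 R (snd (snd p)),
      h (fst p) (fst (snd p)) (snd (snd p)))" for p
  \<comment> \<open>By \<open>abs_mult_diff_le\<close> each product contributes the sum of the
    bounds of its factors: \<open>\<Lambda> + R\<close> and \<open>1 + 1\<close>. The further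
    \<open>2\<close> in \<open>L\<close> accounts for the first two components.\<close>
  define Lh where "Lh = b * (\<Lambda> + R) + (1 + 2 * b) * 2"
  define L where "L = 2 + Lh"
  define B where "B = 1 + R + (b * (\<Lambda> * R) + (1 + 2 * b))"
  have Lh: "Lh > 0" using assms by (simp add: Lh_def add_pos_pos)
  have L: "L > 0" using Lh by (simp add: L_def)
  have comp: "\<bar>fst p\<bar> \<le> norm p" "\<bar>fst (snd p)\<bar> \<le> norm p" "\<bar>snd (snd p)\<bar> \<le> norm p"
    for p :: "real \<times> real \<times> real"
    using norm_fst_le[of "fst p" "snd p"] norm_snd_le[of "snd p" "fst p"]
      norm_fst_le[of "fst (snd p)" "snd (snd p)"] norm_snd_le[of "snd (snd p)" "fst (snd p)"]
    by auto
  have n3: "norm (u, v, w) \<le> \<bar>u\<bar> + \<bar>v\<bar> + \<bar>w\<bar>" for u v w :: real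
    using norm_Pair_le[of u "(v, w)"] norm_Pair_le[of v w] by simp
  have cl: "\<bar>clamp_real (-\<Lambda>) \<Lambda> t\<bar> \<le> \<Lambda>" "\<bar>clamp_real 0 R t\<bar> \<le> R" "\<bar>clamp_real (-1) 0 t\<bar> \<le> 1" for t
    using clamp_real_bounds[of "-\<Lambda>" \<Lambda> t] clamp_real_bounds[of 0 R t] clamp_real_bounds[of "-1" 0 t] \<Lambda> R
    by auto
  have lip: "norm (g p - g q) \<le> L * norm (p - q)" for p q
  proof -
    define d where "d = norm (p - q)"
    have d: "\<bar>fst p - fst q\<bar> \<le> d" "\<bar>fst (snd p) - fst (snd q)\<bar> \<le> d" "\<bar>snd (snd p) - snd (snd q)\<bar> \<le> d"
      using comp[of "p - q"] by (auto simp: d_def)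
    have c: "\<bar>clamp_real l u (fst p) - clamp_real l u (fst q)\<bar> \<le> d"
      "\<bar>clamp_real l u (fst (snd p)) - clamp_real l u (fst (snd q))\<bar> \<le> d"
      "\<bar>clamp_real l u (snd (snd p)) - clamp_real l u (snd (snd q))\<bar> \<le> d" for l u
      using d clamp_real_lipschitz order_trans by blast+
    have 1: "\<bar>clamp_real (-\<Lambda>) \<Lambda> (fst p) * clamp_real 0 R (snd (snd p))
        - clamp_real (-\<Lambda>) \<Lambda> (fst q) * clamp_real 0 R (snd (snd q))\<bar> \<le> (\<Lambda> + R) * d"
      by (intro abs_mult_diff_le cl c)
    have 2: "\<bar>clamp_real (-1) 0 (fst (snd p)) * clamp_real (-1) 0 (fst (snd p))
        - clamp_real (-1) 0 (fst (snd q)) * clamp_real (-1) 0 (fst (snd q))\<bar> \<le> (1 + 1) * d"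
      by (intro abs_mult_diff_le cl c)
    define A where "A = clamp_real (-\<Lambda>) \<Lambda> (fst p) * clamp_real 0 R (snd (snd p))
        - clamp_real (-\<Lambda>) \<Lambda> (fst q) * clamp_real 0 R (snd (snd q))"
    define E where "E = clamp_real (-1) 0 (fst (snd p)) * clamp_real (-1) 0 (fst (snd p))
        - clamp_real (-1) 0 (fst (snd q)) * clamp_real (-1) 0 (fst (snd q))"
    have "h (fst p) (fst (snd p)) (snd (snd p)) - h (fst q) (fst (snd q)) (snd (snd q)) = b * A - (1 + 2 * b) * E"
      unfolding h_def A_def E_def by (simp add: algebra_simps)
    also have "\<bar>b * A - (1 + 2 * b) * E\<bar> \<le> b * \<bar>A\<bar> + (1 + 2 * b) * \<bar>E\<bar>"
      using abs_triangle_ineq4[of "b * A" "(1 + 2 * b) * E"] b by (simp add: abs_mult)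
    also have "\<dots> \<le> b * ((\<Lambda> + R) * d) + (1 + 2 * b) * ((1 + 1) * d)"
      using 1 2 b unfolding A_def E_def by (intro add_mono mult_left_mono) auto
    also have "\<dots> = Lh * d" by (simp add: Lh_def algebra_simps)
    finally have 3: "\<bar>h (fst p) (fst (snd p)) (snd (snd p)) - h (fst q) (fst (snd q)) (snd (snd q))\<bar> \<le> Lh * d" .
    have "norm (g p - g q) \<le> d + d + Lh * d"
      unfolding g_def using n3 3 c(2)[of "-1" 0] c(3)[of 0 R]
      by (simp only: diff_Pair) (smt (verit) n3)
    then show ?thesis by (simp add: L_def d_def algebra_simps)
  qed
  have bnd: "norm (g p) \<le> B" for p
  proof -
    have h: "\<bar>h u v w\<bar> \<le> b * (\<Lambda> * R) + (1 + 2 * b) * (1 * 1)" for u v w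
    proof -
      have "\<bar>h u v w\<bar> \<le> b * (\<bar>clamp_real (-\<Lambda>) \<Lambda> u\<bar> * \<bar>clamp_real 0 R w\<bar>)
          + (1 + 2 * b) * (\<bar>clamp_real (-1) 0 v\<bar> * \<bar>clamp_real (-1) 0 v\<bar>)"
        unfolding h_def by (rule order_trans[OF abs_triangle_ineq4]) (use b in \<open>simp add: abs_mult\<close>)
      also have "\<dots> \<le> b * (\<Lambda> * R) + (1 + 2 * b) * (1 * 1)"
        using cl b \<Lambda> R by (intro add_mono mult_left_mono mult_mono) auto
      finally show ?thesis .
    qed
    show ?thesis
      unfolding g_def B_def
      using n3[of "clamp_real (-1) 0 (fst (snd p))" "clamp_real 0 R (snd (snd p))" "h (fst p) (fst (snd p)) (snd (snd p))"]
        cl(3)[of "fst (snd p)"] cl(2)[of "snd (snd p)"] h[of "fst p" "fst (snd p)" "snd (snd p)"]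
      by simp
  qed
  obtain X where X0: "\<And>p. X p 0 = p"
    and Xd: "\<And>p t. t \<ge> 0 \<Longrightarrow> (X p has_vector_derivative g (X p t)) (at t within {0..})"
    and Xl: "\<And>p q t. t \<ge> 0 \<Longrightarrow> norm (X p t - X q t) \<le> 2 * exp (2 * L * t) * norm (p - q)"
    using lipschitz_flow[OF lip L bnd] by metis
  define x where "x c t = fst (X (a, -1, c) t)" for c t
  define y where "y c t = fst (snd (X (a, -1, c) t))" for c t
  define z where "z c t = snd (snd (X (a, -1, c) t))" for c t
  have gX: "g (X (a, -1, c) t) = (clamp_real (-1) 0 (y c t), clamp_real 0 R (z c t), h (x c t) (y c t) (z c t))" for c t
    by (simp add: g_def x_def y_def z_def)
  have dx: "(x c has_real_derivative clamp_real (-1) 0 (y c t)) (at t within {0..})"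
    and dy: "(y c has_real_derivative clamp_real 0 R (z c t)) (at t within {0..})"
    and dz: "(z c has_real_derivative h (x c t) (y c t) (z c t)) (at t within {0..})" if "t \<ge> 0" for c t
  proof -
    note D = Xd[OF that, of "(a, -1, c)"]
    note D1 = bounded_linear.has_vector_derivative[OF bounded_linear_fst D]
    note D2 = bounded_linear.has_vector_derivative[OF bounded_linear_snd D]
    note D21 = bounded_linear.has_vector_derivative[OF bounded_linear_fst D2]
    note D22 = bounded_linear.has_vector_derivative[OF bounded_linear_snd D2]
    show "(x c has_real_derivative clamp_real (-1) 0 (y c t)) (at t within {0..})"
      using D1 unfolding gX by (simp add: has_real_derivative_iff_has_vector_derivative x_def[abs_def])
    show "(y c has_real_derivative clamp_real 0 R (z c t)) (at t within {0..})"
      using D21 unfolding gX by (simp add: has_real_derivative_iff_has_vector_derivative y_def[abs_def])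
    show "(z c has_real_derivative h (x c t) (y c t) (z c t)) (at t within {0..})"
      using D22 unfolding gX by (simp add: has_real_derivative_iff_has_vector_derivative z_def[abs_def])
  qed
  have Xc: "continuous_on UNIV (\<lambda>c. X (a, -1, c) t)" if "t \<ge> 0" for t
  proof (rule lipschitz_on_continuous_on)
    show "(2 * exp (2 * L * t))-lipschitz_on UNIV (\<lambda>c. X (a, -1, c) t)"
      using Xl[OF that, of "(a, -1, _)" "(a, -1, _)"]
      by (intro lipschitz_onI) (auto simp: dist_norm norm_Pair)
  qed
  show ?thesis
  proof (rule that[of x y z])
    show "x c 0 = a" "y c 0 = -1" "z c 0 = c" for c
      by (simp_all add: x_def y_def z_def X0)
    show "continuous_on UNIV (\<lambda>c. y c t)" "continuous_on UNIV (\<lambda>c. z c t)" if "t \<ge> 0" for t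
      unfolding y_def z_def using Xc[OF that] by (auto intro!: continuous_intros)
    show "\<forall>t\<ge>0. (z c has_real_derivative
          b * clamp_real (-\<Lambda>) \<Lambda> (x c t) * clamp_real 0 R (z c t)
          - (1 + 2 * b) * (clamp_real (-1) 0 (y c t))\<^sup>2) (at t within {0..})" for c
      using dz[of _ c] unfolding h_def by (simp add: power2_eq_square mult.assoc)
  qed (use dx dy in auto)
qed

subsection \<open>Shooting\<close>

lemma le_diff_add_of_le: "q \<le> k \<Longrightarrow> g \<le> p \<Longrightarrow> g \<le> p - q + (k::real)"
  by simp

context
  fixes a b \<Lambda> R c :: real and x y z :: "real \<Rightarrow> real"
  assumes b: "b > 0" and \<Lambda>: "\<Lambda> > 0" and R: "R > 0"
    and x0: "x 0 = a" and y0: "y 0 = -1" and z0: "z 0 = c"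
    and dx: "\<forall>t\<ge>0. (x has_real_derivative clamp_real (-1) 0 (y t)) (at t within {0..})"
    and dy: "\<forall>t\<ge>0. (y has_real_derivative clamp_real 0 R (z t)) (at t within {0..})"
    and dz: "\<forall>t\<ge>0. (z has_real_derivative
          b * clamp_real (-\<Lambda>) \<Lambda> (x t) * clamp_real 0 R (z t)
          - (1 + 2 * b) * (clamp_real (-1) 0 (y t))\<^sup>2) (at t within {0..})"
begin

lemma clamped_z_deriv_ge:
  "b * clamp_real (-\<Lambda>) \<Lambda> (x t) * clamp_real 0 R (z t) \<ge> - (b * \<Lambda>) * clamp_real 0 R (z t)"
proof -
  have "b * (-\<Lambda>) * clamp_real 0 R (z t) \<le> b * clamp_real (-\<Lambda>) \<Lambda> (x t) * clamp_real 0 R (z t)"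
    using b \<Lambda> R clamp_real_bounds[of "-\<Lambda>" \<Lambda> "x t"] clamp_real_bounds[of 0 R "z t"]
    by (intro mult_right_mono mult_left_mono) auto
  then show ?thesis by simp
qed

lemma clamped_y_mono:
  assumes "0 \<le> s" "s \<le> t"
  shows "y s \<le> y t"
  by (rule nondecreasing_of_within_derivative[OF dy assms]) (use clamp_real_bounds[of 0 R] R in auto)

text \<open>Where \<open>z\<close> is nonpositive its clamped value is \<open>0\<close>, so only the
  nonpositive square term remains in the derivative of \<open>z\<close>. This is the barrier lemma
  for \<open>- z\<close> with rate \<open>0\<close>.\<close>

lemma clamped_z_negative_persists:
  assumes "0 \<le> t" "t \<le> u" "z t < 0"
  shows "z u < 0"
proof -
  define g where "g v = - z v" for v
  define g' where "g' v = - (b * clamp_real (-\<Lambda>) \<Lambda> (x v) * clamp_real 0 R (z v)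
          - (1 + 2 * b) * (clamp_real (-1) 0 (y v))\<^sup>2)" for v
  have dg: "\<forall>v\<ge>0. (g has_real_derivative g' v) (at v within {0..})"
    unfolding g_def[abs_def] g'_def using dz by (intro allI impI DERIV_minus) blast
  have "g u \<ge> g t * exp (- 0 * (u - t))"
  proof (rule positivity_barrier[OF assms(2)])
    show "continuous_on {t..u} g"
      by (rule continuous_on_of_within_derivative[OF dg]) (use assms(1) in simp)
    fix v assume v: "t < v" "v < u"
    then show "(g has_real_derivative g' v) (at v)"
      using dg assms(1) by (intro has_real_derivative_at_of_within) simp_all
    assume "\<And>w. t \<le> w \<Longrightarrow> w \<le> v \<Longrightarrow> 0 \<le> g w"
    from this[OF less_imp_le[OF v(1)] order_refl] have z0: "clamp_real 0 R (z v) = 0"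
      using R by (simp add: clamp_real_def g_def)
    have "0 \<le> (1 + 2 * b) * (clamp_real (-1) 0 (y v))\<^sup>2" using b by simp
    then show "- 0 * g v \<le> g' v"
      unfolding g'_def z0 by simp
  next
    show "0 < g t" using assms(3) by (simp add: g_def)
  qed
  then show ?thesis using assms(3) by (simp add: g_def)
qed

text \<open>Crossing into \<open>y > 0\<close> requires a time \<open>p\<close> with
  \<open>y p > 0\<close> and \<open>z p > 0\<close>. Before \<open>p\<close>, a negative
  \<open>z\<close> would have persisted up to \<open>p\<close>. After \<open>p\<close>,
  \<open>y\<close> stays positive, its clamped square is \<open>0\<close>, and \<open>z\<close>
  decays at most exponentially.\<close>

lemma clamped_not_both:
  assumes s: "0 \<le> s" "y s > 0" and t: "0 \<le> t" "z t < 0"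
  shows False
proof -
  have "continuous_on {0..s} y"
    by (intro continuous_on_of_within_derivative[OF dy]) auto
  \<comment> \<open>Applying the mean value theorem between heights \<open>y s / 2\<close> and
    \<open>y s\<close> yields a time at which \<open>y\<close> is already positive and still
    increasing.\<close>
  then obtain r where r: "0 \<le> r" "r \<le> s" "y r = y s / 2"
    using IVT'[of y 0 "y s / 2" s] s y0 by force
  then have "r < s" using s by (cases "r = s") auto
  then obtain p where p: "r < p" "p < s" "y s - y r = (s - r) * clamp_real 0 R (z p)"
    by (rule mvt_of_within_derivative[OF dy r(1)])
  have "(s - r) * clamp_real 0 R (z p) > 0" unfolding p(3)[symmetric] using r s by simp
  then have "clamp_real 0 R (z p) > 0"
    using zero_less_mult_pos[of "s - r" "clamp_real 0 R (z p)"] \<open>r < s\<close> by simp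
  then have zp: "z p > 0" by (simp add: clamp_real_def max_def min_def split: if_splits)
  show False
  proof (cases "t \<le> p")
    case True
    then show False using clamped_z_negative_persists[of t p] t zp by simp
  next
    case False
    have "z t \<ge> z p * exp (- (b * \<Lambda>) * (t - p))"
    proof (rule positivity_barrier)
      show "p \<le> t" using False by simp
      show "continuous_on {p..t} z"
        using r p by (intro continuous_on_of_within_derivative[OF dz]) auto
      fix v assume v: "p < v" "v < t"
      show "(z has_real_derivative (b * clamp_real (-\<Lambda>) \<Lambda> (x v) * clamp_real 0 R (z v)
          - (1 + 2 * b) * (clamp_real (-1) 0 (y v))\<^sup>2)) (at v)"
        by (rule has_real_derivative_at_of_within[OF dz[rule_format]]) (use v p r in linarith)+
      assume "\<And>w. p \<le> w \<Longrightarrow> w \<le> v \<Longrightarrow> 0 \<le> z w"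
      from this[of v] have zv: "clamp_real 0 R (z v) \<le> z v" using v R by (simp add: clamp_real_def)
      have "y v \<ge> y r" using clamped_y_mono[of r v] r p v by auto
      then have yv: "clamp_real (-1) 0 (y v) = 0" using r s by (simp add: clamp_real_def)
      have "- (b * \<Lambda>) * z v \<le> - (b * \<Lambda>) * clamp_real 0 R (z v)"
        using mult_left_mono[OF zv, of "b * \<Lambda>"] b \<Lambda> by simp
      then show "- (b * \<Lambda>) * z v \<le> b * clamp_real (-\<Lambda>) \<Lambda> (x v) * clamp_real 0 R (z v)
          - (1 + 2 * b) * (clamp_real (-1) 0 (y v))\<^sup>2"
        using clamped_z_deriv_ge[of v] yv by simp
    qed (use zp in auto)
    moreover have "z p * exp (- (b * \<Lambda>) * (t - p)) > 0" using zp by simp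
    ultimately show False using t by simp
  qed
qed

text \<open>On the unit interval the linear term costs at most the factor
  \<open>exp (b * \<Lambda>)\<close> and the square at most \<open>1 + 2 * b\<close>. The chosen
  \<open>c\<close> leaves \<open>z \<ge> 2\<close>, and as \<open>R \<ge> 2\<close> the slope of
  \<open>y\<close> is at least \<open>2\<close>, so \<open>y\<close> climbs from \<open>-1\<close>
  to at least \<open>1\<close>.\<close>

lemma clamped_overshoots:
  assumes c: "c = (3 + 2 * b) * exp (b * \<Lambda>)" and R2: "R \<ge> 2"
  shows "y 1 > 0"
proof -
  have z2: "z t \<ge> 2" if t: "0 \<le> t" "t \<le> 1" for t
  proof -
    \<comment> \<open>The added linear term compensates the square, whose clamped argument has
      absolute value at most \<open>1\<close>.\<close>
    define g where "g u = z u + (1 + 2 * b) * u" for u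
    have "g t \<ge> g 0 * exp (- (b * \<Lambda>) * (t - 0))"
    proof (rule positivity_barrier[OF t(1)])
      show "continuous_on {0..t} g"
        unfolding g_def[abs_def] by (intro continuous_intros continuous_on_of_within_derivative[OF dz]) auto
      fix v assume v: "0 < v" "v < t"
      have "(z has_real_derivative (b * clamp_real (-\<Lambda>) \<Lambda> (x v) * clamp_real 0 R (z v)
          - (1 + 2 * b) * (clamp_real (-1) 0 (y v))\<^sup>2)) (at v)"
        using v dz by (intro has_real_derivative_at_of_within) auto
      then show "(g has_real_derivative (b * clamp_real (-\<Lambda>) \<Lambda> (x v) * clamp_real 0 R (z v)
          - (1 + 2 * b) * (clamp_real (-1) 0 (y v))\<^sup>2) + (1 + 2 * b)) (at v)"
        unfolding g_def[abs_def] by (auto intro!: derivative_eq_intros)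
      assume "\<And>w. 0 \<le> w \<Longrightarrow> w \<le> v \<Longrightarrow> 0 \<le> g w"
      from this[of v] have gv: "g v \<ge> 0" using v by simp
      have "clamp_real 0 R (z v) \<le> g v"
      proof -
        have "0 \<le> (1 + 2 * b) * v" using v b by simp
        then have "z v \<le> g v" by (simp add: g_def)
        then show ?thesis using gv by (auto simp: clamp_real_def)
      qed
      then have 1: "- (b * \<Lambda>) * g v \<le> - (b * \<Lambda>) * clamp_real 0 R (z v)"
        using mult_left_mono[of "clamp_real 0 R (z v)" "g v" "b * \<Lambda>"] b \<Lambda> by simp
      have "(clamp_real (-1) 0 (y v))\<^sup>2 \<le> 1"
        using clamp_real_bounds[of "-1" 0 "y v"] by (simp add: abs_square_le_1)
      then have "(1 + 2 * b) * (clamp_real (-1) 0 (y v))\<^sup>2 \<le> (1 + 2 * b) * 1"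
        using b by (intro mult_left_mono) auto
      then show "- (b * \<Lambda>) * g v \<le> b * clamp_real (-\<Lambda>) \<Lambda> (x v) * clamp_real 0 R (z v)
          - (1 + 2 * b) * (clamp_real (-1) 0 (y v))\<^sup>2 + (1 + 2 * b)"
        using order_trans[OF 1 clamped_z_deriv_ge[of v]] by (intro le_diff_add_of_le) simp_all
    qed (use b c z0 in \<open>auto simp: g_def\<close>)
    also have "g 0 * exp (- (b * \<Lambda>) * (t - 0)) = (3 + 2 * b) * exp (b * \<Lambda> * (1 - t))"
      using c z0 by (simp add: g_def mult.assoc exp_add [symmetric] right_diff_distrib)
    finally have 1: "(3 + 2 * b) * exp (b * \<Lambda> * (1 - t)) \<le> g t" .
    have "(3 + 2 * b) * 1 \<le> (3 + 2 * b) * exp (b * \<Lambda> * (1 - t))"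
      using b \<Lambda> t by (intro mult_left_mono) auto
    moreover have "(1 + 2 * b) * t \<le> (1 + 2 * b) * 1" using b t by (intro mult_left_mono) auto
    moreover have "2 \<le> A" if "(3 + 2 * b) * 1 \<le> E" "B \<le> (1 + 2 * b) * 1" "E \<le> A + B" for A B E :: real
      using that by simp
    ultimately show ?thesis using 1 unfolding g_def by blast
  qed
  obtain u where "0 < u" "u < 1" "y 1 - y 0 = (1 - 0) * clamp_real 0 R (z u)"
    using mvt_of_within_derivative[OF dy, of 0 1] by auto
  then show ?thesis using z2[of u] R2 y0 by (auto simp: clamp_real_def)
qed

text \<open>At time \<open>0\<close> the linear term vanishes with \<open>z\<close>, and
  \<open>y = -1\<close> gives \<open>z\<close> the slope \<open>- (1 + 2 * b)\<close>.\<close>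

lemma clamped_undershoots:
  assumes "c = 0"
  shows "\<exists>t\<ge>0. z t < 0"
proof -
  have "(z has_real_derivative - (1 + 2 * b)) (at 0 within {0..})"
    using dz[rule_format, of 0] z0 y0 assms R by (simp add: clamp_real_def)
  from has_real_derivative_neg_dec_right[OF this] b
  obtain d where d: "d > 0" "\<And>h. h > 0 \<Longrightarrow> h < d \<Longrightarrow> z h < 0"
    using z0 assms by auto
  then show ?thesis by (intro exI[of _ "d / 2"]) auto
qed

text \<open>If \<open>y\<close> stayed below a negative constant, then \<open>x\<close> would become negative and \<open>z\<close> would
  decrease at least linearly.\<close>

lemma clamped_y_tendsto_0:
  assumes yneg: "\<forall>t\<ge>0. y t \<le> 0" and znn: "\<forall>t\<ge>0. z t \<ge> 0"
  shows "(y \<longlongrightarrow> 0) at_top"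
proof (rule ccontr)
  have ym: "-1 \<le> y t" if "t \<ge> 0" for t using clamped_y_mono[of 0 t] y0 that by simp
  assume "\<not> (y \<longlongrightarrow> 0) at_top"
  then obtain e where e: "e > 0" "\<And>t. \<exists>s\<ge>t. \<bar>y s\<bar> \<ge> e"
    unfolding tendsto_iff eventually_at_top_linorder dist_real_def by (auto simp: not_less)
  have ye: "y t \<le> - e" if "t \<ge> 0" for t
  proof -
    obtain s where "s \<ge> t" "\<bar>y s\<bar> \<ge> e" using e(2) by blast
    moreover have "y s \<le> 0" using yneg \<open>s \<ge> t\<close> that by simp
    ultimately show ?thesis using clamped_y_mono[OF that \<open>s \<ge> t\<close>] by linarith
  qed
  \<comment> \<open>This places \<open>- e\<close> inside the clamping range of \<open>y\<close>, so
    clamped values of \<open>y\<close> are also at most \<open>- e\<close>.\<close>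
  have e1: "e \<le> 1" using ye[of 0] y0 by simp
  \<comment> \<open>Descending from \<open>a\<close> at speed at least \<open>e\<close>,
    \<open>x\<close> is nonpositive from this time on.\<close>
  define T where "T = \<bar>a\<bar> / e"
  have T: "T \<ge> 0" using e by (simp add: T_def)
  have xT: "x t \<le> 0" if "t \<ge> T" for t
  proof (cases "t = 0")
    case True
    then have "a = 0" using that T e unfolding T_def by (simp add: divide_le_0_iff)
    then show ?thesis using x0 True by simp
  next
    case False
    then have "0 < t" using that T by simp
    then obtain u where u: "0 < u" "u < t" "x t - x 0 = (t - 0) * clamp_real (-1) 0 (y u)"
      using mvt_of_within_derivative[OF dx, of 0 t] by auto
    have "clamp_real (-1) 0 (y u) \<le> - e" using ye[of u] u e1 e by (simp add: clamp_real_def)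
    then have "t * clamp_real (-1) 0 (y u) \<le> t * (- e)" using u by (intro mult_left_mono) auto
    moreover have "t * e \<ge> \<bar>a\<bar>" using that e unfolding T_def by (simp add: field_simps)
    ultimately show ?thesis using u x0 by auto
  qed
  define k where "k = (1 + 2 * b) * e\<^sup>2"
  have k: "k > 0" using b e by (simp add: k_def)
  \<comment> \<open>Falling at rate at least \<open>k\<close> from time \<open>T\<close>,
    \<open>z\<close> would have reached \<open>-1\<close> by now.\<close>
  define t where "t = T + (z T + 1) / k"
  have zT: "z T \<ge> 0" using znn T by simp
  have "t > T" using k zT by (simp add: t_def)
  then obtain u where u: "T < u" "u < t" "z t - z T = (t - T) * (b * clamp_real (-\<Lambda>) \<Lambda> (x u) * clamp_real 0 R (z u)
          - (1 + 2 * b) * (clamp_real (-1) 0 (y u))\<^sup>2)"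
    using mvt_of_within_derivative[OF dz T] by metis
  have "clamp_real (-\<Lambda>) \<Lambda> (x u) \<le> 0" using xT[of u] u \<Lambda> by (simp add: clamp_real_def)
  then have 1: "b * clamp_real (-\<Lambda>) \<Lambda> (x u) * clamp_real 0 R (z u) \<le> 0"
    using b R clamp_real_bounds[of 0 R "z u"] by (simp add: mult_nonneg_nonpos mult_nonpos_nonneg)
  have "\<bar>e\<bar> \<le> \<bar>clamp_real (-1) 0 (y u)\<bar>" using ye[of u] u T e e1 by (simp add: clamp_real_def)
  then have "e\<^sup>2 \<le> (clamp_real (-1) 0 (y u))\<^sup>2" by (simp only: abs_le_square_iff)
  then have "k \<le> (1 + 2 * b) * (clamp_real (-1) 0 (y u))\<^sup>2"
    unfolding k_def using b by (intro mult_left_mono) auto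
  with 1 have "b * clamp_real (-\<Lambda>) \<Lambda> (x u) * clamp_real 0 R (z u)
          - (1 + 2 * b) * (clamp_real (-1) 0 (y u))\<^sup>2 \<le> - k" by linarith
  then have "z t - z T \<le> (t - T) * (- k)"
    unfolding u(3) using u by (intro mult_left_mono) auto
  also have "\<dots> = - (z T + 1)" using k by (simp add: t_def)
  finally show False using znn[rule_format, of t] \<open>t > T\<close> T by simp
qed

text \<open>Once \<open>x \<le> -1\<close>, the quantity \<open>z + b y\<close> decreases to a nonnegative limit, so \<open>y + b x\<close>
  increases and \<open>x\<close> stays bounded below.\<close>

lemma clamped_bounds:
  assumes yneg: "\<forall>t\<ge>0. y t \<le> 0" and znn: "\<forall>t\<ge>0. z t \<ge> 0"
    and \<Lambda>a: "\<Lambda> = \<bar>a\<bar> + 1 + 1 / b" and Rc: "R \<ge> c + b * \<bar>a\<bar>"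
  shows "\<forall>t\<ge>0. -1 \<le> y t" "\<forall>t\<ge>0. z t \<le> R" "\<forall>t\<ge>0. - \<Lambda> \<le> x t \<and> x t \<le> \<bar>a\<bar>"
proof -
  have "0 \<le> 1 / b" using b by simp
  then have \<Lambda>1: "1 \<le> \<Lambda>" unfolding \<Lambda>a by linarith
  have ym: "-1 \<le> y t" if "t \<ge> 0" for t using clamped_y_mono[of 0 t] y0 that by simp
  then show "\<forall>t\<ge>0. -1 \<le> y t" by simp
  have ycl: "clamp_real (-1) 0 (y t) = y t" if "t \<ge> 0" for t
    using that ym yneg by (intro clamp_real_eq) auto
  have xdec: "x t \<le> x s" if "0 \<le> s" "s \<le> t" for s t
  proof -
    have "\<forall>t\<ge>0. ((\<lambda>t. - x t) has_real_derivative - clamp_real (-1) 0 (y t)) (at t within {0..})"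
      using dx by (auto intro!: DERIV_minus)
    from nondecreasing_of_within_derivative[OF this that] ycl yneg that show ?thesis by force
  qed
  have xa: "x t \<le> \<bar>a\<bar>" if "t \<ge> 0" for t using xdec[of 0 t] x0 that by simp
  have clx: "clamp_real (-\<Lambda>) \<Lambda> (x t) \<le> \<bar>a\<bar>" if "t \<ge> 0" for t
    using xa[OF that] \<Lambda>a b \<Lambda> by (auto simp: clamp_real_def)
  show zR: "\<forall>t\<ge>0. z t \<le> R"
  proof (intro allI impI)
    fix t :: real assume t: "t \<ge> 0"
    \<comment> \<open>Since \<open>x \<le> \<bar>a\<bar>\<close>, the derivative of \<open>z\<close>
      is at most \<open>b * \<bar>a\<bar>\<close> times that of \<open>y\<close>. As
      \<open>y\<close> rises by at most \<open>1\<close>, \<open>z\<close> rises by at most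
      \<open>b * \<bar>a\<bar>\<close>, which explains the lower bound demanded of
      \<open>R\<close>.\<close>
    define g where "g t = b * \<bar>a\<bar> * y t - z t" for t
    have "\<forall>t\<ge>0. (g has_real_derivative b * \<bar>a\<bar> * clamp_real 0 R (z t) - (b * clamp_real (-\<Lambda>) \<Lambda> (x t) * clamp_real 0 R (z t)
          - (1 + 2 * b) * (clamp_real (-1) 0 (y t))\<^sup>2)) (at t within {0..})"
      unfolding g_def[abs_def] using dy dz by (auto intro!: DERIV_diff DERIV_cmult)
    then have "g 0 \<le> g t"
    proof (rule nondecreasing_of_within_derivative)
      fix u :: real assume u: "0 < u"
      have "b * clamp_real (-\<Lambda>) \<Lambda> (x u) * clamp_real 0 R (z u) \<le> b * \<bar>a\<bar> * clamp_real 0 R (z u)"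
        using b R clx[of u] u clamp_real_bounds[of 0 R "z u"] by (intro mult_right_mono mult_left_mono) auto
      moreover have "0 \<le> (1 + 2 * b) * (clamp_real (-1) 0 (y u))\<^sup>2" using b by simp
      ultimately show "0 \<le> b * \<bar>a\<bar> * clamp_real 0 R (z u) - (b * clamp_real (-\<Lambda>) \<Lambda> (x u) * clamp_real 0 R (z u)
          - (1 + 2 * b) * (clamp_real (-1) 0 (y u))\<^sup>2)" by linarith
    qed (use t in auto)
    moreover have "b * \<bar>a\<bar> * y t \<le> 0" using b yneg t by (simp add: mult_nonneg_nonpos)
    ultimately show "z t \<le> R" using Rc y0 z0 by (simp add: g_def)
  qed
  have zcl: "clamp_real 0 R (z t) = z t" if "t \<ge> 0" for t
    using that zR znn by (intro clamp_real_eq) auto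
  have "- \<Lambda> \<le> x t" if t: "t \<ge> 0" for t
  proof (cases "x t \<le> -1")
    case False
    then show ?thesis using \<Lambda>1 by linarith
  next
    case True
    \<comment> \<open>A time in the region \<open>x \<le> -1\<close> with controlled depth: time
      \<open>0\<close> if \<open>a \<le> -1\<close>, otherwise a time at which
      \<open>x = -1\<close>.\<close>
    have "\<exists>T\<ge>0. T \<le> t \<and> x T \<le> -1 \<and> x T \<ge> - \<bar>a\<bar> - 1"
    proof (cases "a \<le> -1")
      case True
      then show ?thesis using t x0 by (intro exI[of _ 0]) auto
    next
      case False
      have "continuous_on {0..t} x"
        by (intro continuous_on_of_within_derivative[OF dx]) auto
      then obtain r where "0 \<le> r" "r \<le> t" "x r = -1"
        using IVT2'[of x t "-1" 0] t True False x0 by auto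
      then show ?thesis by (intro exI[of _ r]) auto
    qed
    then obtain T where T: "T \<ge> 0" "T \<le> t" "x T \<le> -1" "x T \<ge> - \<bar>a\<bar> - 1" by blast
    have zy: "z u + b * y u \<ge> 0" if u: "u \<ge> T" for u
    proof (rule ccontr)
      assume neg: "\<not> z u + b * y u \<ge> 0"
      have dec: "z v + b * y v \<le> z u + b * y u" if "v \<ge> u" for v
      proof -
        define g where "g t = - z t - b * y t" for t
        have "\<forall>t\<ge>0. (g has_real_derivative - (b * clamp_real (-\<Lambda>) \<Lambda> (x t) * clamp_real 0 R (z t)
          - (1 + 2 * b) * (clamp_real (-1) 0 (y t))\<^sup>2) - b * clamp_real 0 R (z t)) (at t within {0..})"
          unfolding g_def[abs_def] using dy dz by (intro allI impI DERIV_diff DERIV_cmult DERIV_minus) auto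
        then have "g u \<le> g v"
        proof (rule nondecreasing_of_within_derivative)
          fix w assume w: "u < w"
          have "x w \<le> -1" using xdec[of T w] T u w by simp
          then have "clamp_real (-\<Lambda>) \<Lambda> (x w) \<le> -1"
            using \<Lambda>1 by (auto simp: clamp_real_def)
          then have "b * clamp_real (-\<Lambda>) \<Lambda> (x w) * clamp_real 0 R (z w) \<le> b * (-1) * clamp_real 0 R (z w)"
            using b R clamp_real_bounds[of 0 R "z w"] by (intro mult_right_mono mult_left_mono) auto
          moreover have "0 \<le> (1 + 2 * b) * (clamp_real (-1) 0 (y w))\<^sup>2" using b by simp
          ultimately show "0 \<le> - (b * clamp_real (-\<Lambda>) \<Lambda> (x w) * clamp_real 0 R (z w)
            - (1 + 2 * b) * (clamp_real (-1) 0 (y w))\<^sup>2) - b * clamp_real 0 R (z w)" by linarith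
        qed (use that u T in auto)
        then show ?thesis by (simp add: g_def)
      qed
      \<comment> \<open>A negative value of \<open>z + b y\<close> could only decrease further;
        since \<open>z\<close> is nonnegative, \<open>y\<close> would stay below \<open>- d\<close>
        and could not tend to \<open>0\<close>.\<close>
      define d where "d = - (z u + b * y u) / b"
      have d: "d > 0" using neg b by (simp add: d_def field_simps)
      have yd: "y v \<le> - d" if "v \<ge> u" for v
      proof -
        have "b * y v \<le> z u + b * y u"
          using dec[OF that] znn[rule_format, of v] that u T by linarith
        then show ?thesis using b by (simp add: d_def field_simps)
      qed
      have "((\<lambda>t. y t) \<longlongrightarrow> 0) at_top" using clamped_y_tendsto_0[OF yneg znn] .
      moreover have "\<forall>\<^sub>F v in at_top. y v \<le> - d"
        using yd unfolding eventually_at_top_linorder by blast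
      ultimately have "0 \<le> - d" by (rule tendsto_upperbound) simp
      then show False using d by simp
    qed
    \<comment> \<open>As \<open>y\<close> lies between \<open>-1\<close> and \<open>0\<close>, this
      bounds \<open>b * x t\<close> below by \<open>- b * (\<bar>a\<bar> + 1) - 1\<close>, which is
      \<open>- b * \<Lambda>\<close>; here the value of \<open>\<Lambda>\<close> originates.\<close>
    have "y T + b * x T \<le> y t + b * x t"
    proof (rule nondecreasing_of_within_derivative[of "\<lambda>t. y t + b * x t"])
      show "\<forall>t\<ge>0. ((\<lambda>t. y t + b * x t) has_real_derivative
          clamp_real 0 R (z t) + b * clamp_real (-1) 0 (y t)) (at t within {0..})"
        using dx dy by (auto intro!: DERIV_add DERIV_cmult)
      fix u assume "T < u"
      then show "0 \<le> clamp_real 0 R (z u) + b * clamp_real (-1) 0 (y u)"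
        using zy[of u] zcl[of u] ycl[of u] T by simp
    qed (use T in auto)
    moreover have "b * (- \<bar>a\<bar> - 1) \<le> b * x T" using T b by (intro mult_left_mono) auto
    ultimately have "b * x t \<ge> b * (- \<bar>a\<bar> - 1) - 1"
      using ym[of T] yneg[rule_format, of t] T t by linarith
    also have "b * (- \<bar>a\<bar> - 1) - 1 = b * (- \<Lambda>)" using b by (simp add: \<Lambda>a algebra_simps)
    finally show ?thesis using mult_le_cancel_left_pos[OF b] by blast
  qed
  then show "\<forall>t\<ge>0. - \<Lambda> \<le> x t \<and> x t \<le> \<bar>a\<bar>" using xa by simp
qed

end

section \<open>Existence: a shooting parameter that fails in neither way\<close>

lemma ex_monotone_profile:
  fixes a b :: real
  assumes b: "b > 0"
  obtains f f1 f2 M where "\<forall>t\<ge>0. (f has_real_derivative f1 t) (at t within {0..})"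
    and "\<forall>t\<ge>0. (f1 has_real_derivative f2 t) (at t within {0..})"
    and "\<forall>t\<ge>0. (f2 has_real_derivative b * f t * f2 t - (1 + 2 * b) * (f1 t)\<^sup>2) (at t within {0..})"
    and "f 0 = a" "f1 0 = -1" "(f1 \<longlongrightarrow> 0) at_top" "\<forall>t\<ge>0. f2 t \<ge> 0" "\<forall>t\<ge>0. \<bar>f t\<bar> \<le> M"
proof -
  \<comment> \<open>\<open>\<Lambda>\<close> and \<open>R\<close> are the a priori bounds of
    \<open>clamped_bounds\<close>, taken uniformly over \<open>c\<close> in \<open>{0..C}\<close>,
    and \<open>C\<close> is the slope of \<open>clamped_overshoots\<close>.\<close>
  define \<Lambda> where "\<Lambda> = \<bar>a\<bar> + 1 + 1 / b"
  define C where "C = (3 + 2 * b) * exp (b * \<Lambda>)"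
  define R where "R = C + b * \<bar>a\<bar>"
  have \<Lambda>: "\<Lambda> > 0" using b by (simp add: \<Lambda>_def add_nonneg_pos)
  have "(3 + 2 * b) * 1 \<le> C" unfolding C_def using b \<Lambda> by (intro mult_left_mono) auto
  then have C: "C \<ge> 3" using b by simp
  have "0 \<le> b * \<bar>a\<bar>" using b by simp
  then have R2: "R \<ge> 2" using C unfolding R_def by linarith
  then have R: "R > 0" by simp
  obtain x y z :: "real \<Rightarrow> real \<Rightarrow> real"
    where d: "\<And>c. \<forall>t\<ge>0. (x c has_real_derivative clamp_real (-1) 0 (y c t)) (at t within {0..})"
      "\<And>c. \<forall>t\<ge>0. (y c has_real_derivative clamp_real 0 R (z c t)) (at t within {0..})"
      "\<And>c. \<forall>t\<ge>0. (z c has_real_derivative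
          b * clamp_real (-\<Lambda>) \<Lambda> (x c t) * clamp_real 0 R (z c t)
          - (1 + 2 * b) * (clamp_real (-1) 0 (y c t))\<^sup>2) (at t within {0..})"
    and i: "\<And>c. x c 0 = a" "\<And>c. y c 0 = -1" "\<And>c. z c 0 = c"
    and cont: "\<And>t. t \<ge> 0 \<Longrightarrow> continuous_on UNIV (\<lambda>c. y c t)"
      "\<And>t. t \<ge> 0 \<Longrightarrow> continuous_on UNIV (\<lambda>c. z c t)"
    by (rule clamped_flow[OF b \<Lambda> R, of a]) (rule that; assumption)
  note D = b \<Lambda> R i d
  define U where "U = (\<Union>t\<in>{0..}. {c. y c t > 0})"
  define V where "V = (\<Union>t\<in>{0..}. {c. z c t < 0})"
  have oU: "open U"
    unfolding U_def by (intro open_UN ballI open_Collect_less continuous_on_const cont) simp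
  have oV: "open V"
    unfolding V_def by (intro open_UN ballI open_Collect_less continuous_on_const cont) simp
  have disj: "U \<inter> V \<inter> {0..C} = {}"
    using clamped_not_both[OF D] by (auto simp: U_def V_def)
  have "C \<in> U" unfolding U_def using clamped_overshoots[OF D C_def R2] by (intro UN_I[of 1]) auto
  then have neU: "U \<inter> {0..C} \<noteq> {}" using C by auto
  have "0 \<in> V" using clamped_undershoots[OF D] by (auto simp: V_def)
  then have neV: "V \<inter> {0..C} \<noteq> {}" using C by auto
  have "\<not> {0..C} \<subseteq> U \<union> V"
  proof
    assume "{0..C} \<subseteq> U \<union> V"
    from connectedD[OF connected_Icc oU oV disj this] show False using neU neV by (elim disjE) auto
  qed
  then obtain c where "c \<in> {0..C}" "c \<notin> U \<union> V" by blast
  then have c: "0 \<le> c" "c \<le> C" "c \<notin> U" "c \<notin> V" by auto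
  have yn: "\<forall>t\<ge>0. y c t \<le> 0" and zn: "\<forall>t\<ge>0. z c t \<ge> 0"
    using c(3,4) by (auto simp: U_def V_def not_less)
  have Rc: "R \<ge> c + b * \<bar>a\<bar>" using c by (simp add: R_def)
  note B = clamped_bounds[OF D yn zn \<Lambda>_def Rc]
  have le: "\<bar>a\<bar> \<le> \<Lambda>" using b by (simp add: \<Lambda>_def)
  have e: "clamp_real (-1) 0 (y c t) = y c t" "clamp_real 0 R (z c t) = z c t" "clamp_real (-\<Lambda>) \<Lambda> (x c t) = x c t"
    if "t \<ge> 0" for t
  proof -
    have "- \<Lambda> \<le> x c t" "x c t \<le> \<Lambda>" using B(3)[rule_format, OF that] le by linarith+
    then show "clamp_real (-\<Lambda>) \<Lambda> (x c t) = x c t" by (rule clamp_real_eq)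
  qed (use that B(1,2) yn zn in \<open>simp_all add: clamp_real_eq\<close>)
  have 1: "\<forall>t\<ge>0. (x c has_real_derivative y c t) (at t within {0..})"
    using d(1)[of c] by (simp add: e(1))
  have 2: "\<forall>t\<ge>0. (y c has_real_derivative z c t) (at t within {0..})"
    using d(2)[of c] by (simp add: e(2))
  have 3: "\<forall>t\<ge>0. (z c has_real_derivative b * x c t * z c t - (1 + 2 * b) * (y c t)\<^sup>2) (at t within {0..})"
    using d(3)[of c] by (simp add: e)
  have 4: "\<forall>t\<ge>0. \<bar>x c t\<bar> \<le> \<Lambda>"
  proof (intro allI impI)
    fix t :: real assume t: "t \<ge> 0"
    have "- \<Lambda> \<le> x c t \<and> x c t \<le> \<bar>a\<bar>" using B(3) t by blast
    then show "\<bar>x c t\<bar> \<le> \<Lambda>" using le by linarith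
  qed
  show ?thesis
    by (rule that[OF 1 2 3 i(1) i(2) clamped_y_tendsto_0[OF D yn zn] zn 4])
qed

subsection \<open>Convex profiles\<close>

text \<open>The convex boundary value problem for \<open>m = - 1 - 2 * b\<close>, with the third
  derivative eliminated through the equation and convexity expressed by the sign of
  \<open>f2\<close>. The value \<open>f 0\<close> is left free.\<close>

definition monotone_profile :: "real \<Rightarrow> (real \<Rightarrow> real) \<Rightarrow> (real \<Rightarrow> real) \<Rightarrow> (real \<Rightarrow> real) \<Rightarrow> bool" where
  "monotone_profile b f f1 f2 \<longleftrightarrow>
     (\<forall>t\<ge>0. (f has_real_derivative f1 t) (at t within {0..})) \<and>
     (\<forall>t\<ge>0. (f1 has_real_derivative f2 t) (at t within {0..})) \<and>
     (\<forall>t\<ge>0. (f2 has_real_derivative b * f t * f2 t - (1 + 2 * b) * (f1 t)\<^sup>2) (at t within {0..})) \<and>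
     f1 0 = -1 \<and> (f1 \<longlongrightarrow> 0) at_top \<and> (\<forall>t\<ge>0. f2 t \<ge> 0)"

lemma bounded_on_Icc_of_within_derivative:
  fixes g :: "real \<Rightarrow> real"
  assumes "\<forall>t\<ge>0. (g has_real_derivative g' t) (at t within {0..})"
  obtains M where "M \<ge> 0" "\<And>t. 0 \<le> t \<Longrightarrow> t \<le> T \<Longrightarrow> \<bar>g t\<bar> \<le> M"
proof -
  have "continuous_on {0..T} g"
    by (rule continuous_on_of_within_derivative[OF assms]) simp
  then have "bounded (g ` {0..T})"
    by (intro compact_imp_bounded compact_continuous_image) auto
  then obtain M where "M > 0" "\<forall>x\<in>g ` {0..T}. norm x \<le> M"
    unfolding bounded_pos by blast
  then show ?thesis using that[of M] by simp
qed

lemma convex_on_of_within_derivative_mono: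
  fixes f :: "real \<Rightarrow> real"
  assumes d: "\<forall>t\<ge>0. (f has_real_derivative f1 t) (at t within {0..})"
    and d1: "\<forall>t\<ge>0. (f1 has_real_derivative f2 t) (at t within {0..})"
    and nn: "\<forall>t\<ge>0. f2 t \<ge> 0"
  shows "convex_on {0..} f"
proof (rule pos_convex_function)
  have mono: "f1 s \<le> f1 t" if "0 \<le> s" "s \<le> t" for s t
    by (rule nondecreasing_of_within_derivative[OF d1 that]) (use nn that in simp)
  show "convex {0::real..}" by simp
  fix x y :: real assume "x \<in> {0..}" "y \<in> {0..}"
  then have xy: "0 \<le> x" "0 \<le> y" by simp_all
  consider "x < y" | "x = y" | "y < x" by linarith
  then show "f1 x * (y - x) \<le> f y - f x"
  proof cases
    case 1
    obtain u where u: "x < u" "u < y" "f y - f x = (y - x) * f1 u"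
      by (rule mvt_of_within_derivative[OF d xy(1) 1])
    have "(y - x) * f1 x \<le> (y - x) * f1 u"
      using mono[of x u] u xy 1 by (intro mult_left_mono) simp_all
    then show ?thesis unfolding u(3) by (simp add: mult.commute)
  next
    case 3
    obtain u where u: "y < u" "u < x" "f x - f y = (x - y) * f1 u"
      by (rule mvt_of_within_derivative[OF d xy(2) 3])
    have "(x - y) * f1 u \<le> (x - y) * f1 x"
      using mono[of u x] u xy 3 by (intro mult_left_mono) simp_all
    then show ?thesis using u(3) by (simp add: algebra_simps)
  qed simp
qed

text \<open>Adding the tangent inequalities at two interior points shows that \<open>f1\<close> is
  nondecreasing there, which excludes \<open>f2 t < 0\<close>.\<close>

lemma convex_on_imp_second_derivative_nonneg:
  fixes f :: "real \<Rightarrow> real"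
  assumes d: "\<forall>t\<ge>0. (f has_real_derivative f1 t) (at t within {0..})"
    and d1: "\<forall>t\<ge>0. (f1 has_real_derivative f2 t) (at t within {0..})"
    and d2: "\<forall>t\<ge>0. (f2 has_real_derivative f3 t) (at t within {0..})"
    and conv: "convex_on {0..} f"
  shows "\<forall>t\<ge>0. f2 t \<ge> 0"
proof -
  have tangent: "f y - f x \<ge> f1 x * (y - x)" if "0 < x" "0 < y" for x y
    by (rule convex_on_imp_above_tangent[OF conv]) (use that d in simp_all)
  have mono: "f1 x \<le> f1 y" if "0 < x" "x < y" for x y
  proof -
    have "f1 x * (y - x) \<le> f1 y * (y - x)"
      using tangent[of x y] tangent[of y x] that by (simp add: algebra_simps)
    then show ?thesis using that by simp
  qed
  have pos: "f2 t \<ge> 0" if t: "0 < t" for t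
  proof (rule ccontr)
    assume "\<not> f2 t \<ge> 0"
    then obtain e where e: "e > 0" "\<And>h. h > 0 \<Longrightarrow> t + h \<in> {0..} \<Longrightarrow> h < e \<Longrightarrow> f1 t > f1 (t + h)"
      using has_real_derivative_neg_dec_right[of f1 "f2 t" t "{0..}"] d1 t by force
    show False using e(2)[of "e / 2"] mono[of t "t + e / 2"] e(1) t by simp
  qed
  \<comment> \<open>The tangent argument covers interior points; the endpoint follows from
    right-continuity of \<open>f2\<close>.\<close>
  have "f2 0 \<ge> 0"
  proof (rule tendsto_lowerbound)
    show "(f2 \<longlongrightarrow> f2 0) (at_right 0)"
      using DERIV_continuous[OF d2[rule_format, of 0]]
      by (simp add: continuous_within at_within_Ici_at_right)
    show "\<forall>\<^sub>F t in at_right 0. 0 \<le> f2 t"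
      using eventually_at_right_less[of 0] by (rule eventually_mono) (rule pos)
  qed simp
  then show ?thesis using pos by (metis order_le_less)
qed

section \<open>Strict signs, range of the first derivative, and limit of a single profile\<close>

context
  fixes b :: real and f f1 f2 :: "real \<Rightarrow> real"
  assumes b: "b > 0" and prof: "monotone_profile b f f1 f2"
begin

lemma profile_derivs:
  "\<forall>t\<ge>0. (f has_real_derivative f1 t) (at t within {0..})"
  "\<forall>t\<ge>0. (f1 has_real_derivative f2 t) (at t within {0..})"
  "\<forall>t\<ge>0. (f2 has_real_derivative b * f t * f2 t - (1 + 2 * b) * (f1 t)\<^sup>2) (at t within {0..})"
  using prof unfolding monotone_profile_def by blast+

lemma profile_f1_0: "f1 0 = -1"
  and profile_f1_lim: "(f1 \<longlongrightarrow> 0) at_top"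
  and profile_f2_nonneg: "t \<ge> 0 \<Longrightarrow> f2 t \<ge> 0"
  using prof unfolding monotone_profile_def by blast+

lemma profile_f1_mono:
  assumes "0 \<le> s" "s \<le> t"
  shows "f1 s \<le> f1 t"
  by (rule nondecreasing_of_within_derivative[OF profile_derivs(2) assms])
     (use profile_f2_nonneg assms in simp)

lemma profile_f1_bounds:
  assumes "t \<ge> 0"
  shows "-1 \<le> f1 t" "f1 t \<le> 0"
proof -
  show "-1 \<le> f1 t" using profile_f1_mono[of 0 t] assms profile_f1_0 by simp
  show "f1 t \<le> 0"
  proof (rule tendsto_lowerbound[OF profile_f1_lim])
    show "\<forall>\<^sub>F s in at_top. f1 t \<le> f1 s"
      using profile_f1_mono[OF assms] unfolding eventually_at_top_linorder by blast
  qed simp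
qed

text \<open>Backward uniqueness for the linear system satisfied by \<open>f1\<close> and \<open>f2\<close> (with \<open>f\<close> as coefficient).\<close>

lemma profile_nondegenerate:
  assumes T: "T \<ge> 0"
  shows "(f1 T)\<^sup>2 + (f2 T)\<^sup>2 > 0"
proof -
  obtain M where M: "M \<ge> 0" "\<And>t. 0 \<le> t \<Longrightarrow> t \<le> T \<Longrightarrow> \<bar>f t\<bar> \<le> M"
    using bounded_on_Icc_of_within_derivative[OF profile_derivs(1), of T] by metis
  \<comment> \<open>The contributions are \<open>1\<close> from \<open>2 * f1 * f2\<close>,
    \<open>2 * b * M\<close> from the term with coefficient \<open>f\<close>, and
    \<open>1 + 2 * b\<close> from the square.\<close>
  define K where "K = 2 + 2 * b + 2 * b * M"
  define u where "u t = (f1 t)\<^sup>2 + (f2 t)\<^sup>2" for t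
  define u' where "u' t = 2 * f1 t * f2 t + 2 * f2 t * (b * f t * f2 t - (1 + 2 * b) * (f1 t)\<^sup>2)" for t
  have du: "\<forall>t\<ge>0. (u has_real_derivative u' t) (at t within {0..})"
    unfolding u_def[abs_def] u'_def using profile_derivs(2,3)
    by (auto intro!: derivative_eq_intros)
  have u0: "u 0 > 0" by (simp add: u_def profile_f1_0 add_pos_nonneg)
  have "u T \<ge> u 0 * exp (- K * (T - 0))"
  proof (rule positivity_barrier[OF T])
    show "continuous_on {0..T} u"
      by (rule continuous_on_of_within_derivative[OF du]) simp
    fix t assume t: "0 < t" "t < T"
    show "(u has_real_derivative u' t) (at t)"
      by (rule has_real_derivative_at_of_within[OF du[rule_format]]) (use t in simp_all)
    have 1: "- u t \<le> 2 * f1 t * f2 t"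
      using zero_le_power2[of "f1 t + f2 t"] by (simp add: u_def power2_sum)
    have "- M \<le> f t" using M(2)[of t] t by (simp add: abs_le_iff)
    then have "(2 * b * (f2 t)\<^sup>2) * (- M) \<le> (2 * b * (f2 t)\<^sup>2) * f t"
      using b by (intro mult_left_mono) simp_all
    moreover have "(2 * b * M) * (f2 t)\<^sup>2 \<le> (2 * b * M) * u t"
      using b M by (intro mult_left_mono) (simp_all add: u_def)
    ultimately have 2: "- ((2 * b * M) * u t) \<le> 2 * f2 t * (b * f t * f2 t)"
      by (simp add: power2_eq_square mult_ac)
    have "(f1 t)\<^sup>2 \<le> - f1 t"
      using profile_f1_bounds[of t] t mult_left_mono[of "-1" "f1 t" "- f1 t"]
      by (simp add: power2_eq_square)
    then have "2 * f2 t * (f1 t)\<^sup>2 \<le> 2 * f2 t * (- f1 t)"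
      using profile_f2_nonneg[of t] t by (intro mult_left_mono) simp_all
    also have "\<dots> \<le> u t"
      using zero_le_power2[of "f1 t + f2 t"] by (simp add: u_def power2_sum algebra_simps)
    finally have "(1 + 2 * b) * (2 * f2 t * (f1 t)\<^sup>2) \<le> (1 + 2 * b) * u t"
      using b by (intro mult_left_mono) simp_all
    with 1 2 show "- K * u t \<le> u' t"
      unfolding K_def u'_def by (simp add: algebra_simps)
  qed (use u0 in simp)
  then show ?thesis using u0 unfolding u_def[of T, symmetric]
    by (metis exp_gt_zero mult_pos_pos less_le_trans)
qed

text \<open>At a zero of \<open>f1\<close>, nondegeneracy forces \<open>f2 > 0\<close>, and
  \<open>f1\<close> would become positive just afterwards.\<close>

lemma profile_f1_neg:
  assumes "t \<ge> 0"
  shows "f1 t < 0"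
proof (rule ccontr)
  assume "\<not> f1 t < 0"
  then have z: "f1 t = 0" using profile_f1_bounds[OF assms] by simp
  then have "f2 t > 0"
    using profile_nondegenerate[OF assms] profile_f2_nonneg[OF assms] by (simp add: less_le)
  then obtain e where e: "e > 0" "\<And>h. h > 0 \<Longrightarrow> t + h \<in> {0..} \<Longrightarrow> h < e \<Longrightarrow> f1 t < f1 (t + h)"
    using has_real_derivative_pos_inc_right[OF profile_derivs(2)[rule_format, OF assms]] by blast
  show False using e(2)[of "e / 2"] e(1) profile_f1_bounds[of "t + e / 2"] z assms by simp
qed

text \<open>At a zero of \<open>f2\<close> the equation gives \<open>f2\<close> the slope
  \<open>- (1 + 2 * b) * f1^2\<close>, which is negative, so \<open>f2\<close> would become negative
  just afterwards.\<close>

lemma profile_f2_pos: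
  assumes "t \<ge> 0"
  shows "f2 t > 0"
proof (rule ccontr)
  assume "\<not> f2 t > 0"
  then have z: "f2 t = 0" using profile_f2_nonneg[OF assms] by simp
  have "(1 + 2 * b) * (f1 t)\<^sup>2 > 0" using profile_f1_neg[OF assms] b by (intro mult_pos_pos) simp_all
  then have "b * f t * f2 t - (1 + 2 * b) * (f1 t)\<^sup>2 < 0" using z by simp
  then obtain e where e: "e > 0" "\<And>h. h > 0 \<Longrightarrow> t + h \<in> {0..} \<Longrightarrow> h < e \<Longrightarrow> f2 t > f2 (t + h)"
    using has_real_derivative_neg_dec_right[OF profile_derivs(3)[rule_format, OF assms]] by blast
  show False using e(2)[of "e / 2"] e(1) profile_f2_nonneg[of "t + e / 2"] z assms by simp
qed

lemma profile_f1_strict_mono: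
  assumes "0 \<le> s" "s < t"
  shows "f1 s < f1 t"
proof -
  obtain u where u: "s < u" "u < t" "f1 t - f1 s = (t - s) * f2 u"
    by (rule mvt_of_within_derivative[OF profile_derivs(2) assms])
  have "(t - s) * f2 u > 0" using profile_f2_pos[of u] u assms by simp
  then show ?thesis using u by simp
qed

lemma profile_f1_less_iff:
  assumes "0 \<le> s" "0 \<le> t"
  shows "f1 s < f1 t \<longleftrightarrow> s < t"
  using profile_f1_strict_mono[of s t] profile_f1_mono[of t s] assms by linarith

lemma profile_f1_attains:
  assumes "-1 \<le> v" "v < 0"
  shows "\<exists>s\<ge>0. f1 s = v"
proof -
  have "\<forall>\<^sub>F t in at_top. v < f1 t" using order_tendstoD(1)[OF profile_f1_lim assms(2)] .
  then obtain N where N: "\<And>t. t \<ge> N \<Longrightarrow> v < f1 t" unfolding eventually_at_top_linorder by blast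
  have "v < f1 (max 0 N)" by (rule N) simp
  moreover have "continuous_on {0..max 0 N} f1"
    by (rule continuous_on_of_within_derivative[OF profile_derivs(2)]) simp
  ultimately show ?thesis
    using IVT'[of f1 0 v "max 0 N"] profile_f1_0 assms by force
qed

lemma profile_limit_bounds:
  assumes l: "(f \<longlongrightarrow> l) at_top"
  shows "- sqrt ((f 0)\<^sup>2 + 2 / b) < l \<and> l < f 0"
proof
  have fdec: "f t < f s" if st: "0 \<le> s" "s < t" for s t
  proof -
    obtain u where u: "s < u" "u < t" "f t - f s = (t - s) * f1 u"
      by (rule mvt_of_within_derivative[OF profile_derivs(1) st])
    have "(t - s) * f1 u < 0" using profile_f1_neg[of u] u st by (simp add: mult_pos_neg)
    then show ?thesis using u by simp
  qed
  have "l \<le> f 1"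
  proof (rule tendsto_upperbound[OF l])
    show "\<forall>\<^sub>F t in at_top. f t \<le> f 1"
      using eventually_gt_at_top[of 1] by (rule eventually_mono) (use fdec[of 1] in force)
  qed simp
  then show "l < f 0" using fdec[of 0 1] by simp
  \<comment> \<open>Subtracting the derivative of \<open>b f f1\<close> cancels the term
    \<open>b f f2\<close> of the equation and leaves a multiple of \<open>f1^2\<close> with a
    definite sign.\<close>
  define h where "h t = f2 t - b * f t * f1 t" for t
  have dh: "\<forall>t\<ge>0. (h has_real_derivative - ((1 + 3 * b) * (f1 t)\<^sup>2)) (at t within {0..})"
  proof (intro allI impI)
    fix t :: real assume t: "t \<ge> 0"
    have "(h has_real_derivative (b * f t * f2 t - (1 + 2 * b) * (f1 t)\<^sup>2)
        - (b * f1 t * f1 t + f2 t * (b * f t))) (at t within {0..})"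
      unfolding h_def[abs_def] using profile_derivs t
      by (intro DERIV_diff DERIV_mult' DERIV_cmult DERIV_mult) (auto intro!: derivative_eq_intros)
    then show "(h has_real_derivative - ((1 + 3 * b) * (f1 t)\<^sup>2)) (at t within {0..})"
      by (simp add: algebra_simps power2_eq_square)
  qed
  have hdec: "h t < h s" if st: "0 \<le> s" "s < t" for s t
  proof -
    obtain u where u: "s < u" "u < t" "h t - h s = (t - s) * (- ((1 + 3 * b) * (f1 u)\<^sup>2))"
      by (rule mvt_of_within_derivative[OF dh st])
    have "(t - s) * ((1 + 3 * b) * (f1 u)\<^sup>2) > 0"
      using profile_f1_neg[of u] u st b by (intro mult_pos_pos) simp_all
    then show ?thesis using u(3) by simp
  qed
  \<comment> \<open>Because \<open>f2\<close> is nonnegative, \<open>h\<close> lies above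
    \<open>- b f f1\<close>, which tends to \<open>0\<close>. Moving from \<open>t\<close> to
    \<open>t + 1\<close> turns a nonpositive value of \<open>h\<close> into a strictly negative
    one.\<close>
  have hpos: "h t > 0" if t: "0 \<le> t" for t
  proof (rule ccontr)
    assume "\<not> h t > 0"
    then have neg: "h (t + 1) < 0" using hdec[of t "t + 1"] t by simp
    have "((\<lambda>s. - (b * f s * f1 s)) \<longlongrightarrow> - (b * l * 0)) at_top"
      by (intro tendsto_intros l profile_f1_lim)
    moreover have "\<forall>\<^sub>F s in at_top. - (b * f s * f1 s) \<le> h (t + 1)"
      using eventually_gt_at_top[of "t + 1"]
    proof (rule eventually_mono)
      fix s assume "t + 1 < s"
      then show "- (b * f s * f1 s) \<le> h (t + 1)"
        using hdec[of "t + 1" s] profile_f2_nonneg[of s] t by (simp add: h_def)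
    qed
    ultimately have "- (b * l * 0) \<le> h (t + 1)" by (rule tendsto_upperbound) simp
    then show False using neg by simp
  qed
  \<comment> \<open>An antiderivative of \<open>h\<close>. The strict increase on
    \<open>{0..1}\<close> survives the passage to the limit, so the final inequality is
    strict.\<close>
  define G where "G t = f1 t - b / 2 * (f t)\<^sup>2" for t
  have dG: "\<forall>t\<ge>0. (G has_real_derivative h t) (at t within {0..})"
    unfolding G_def[abs_def] h_def using profile_derivs(1,2)
    by (auto intro!: derivative_eq_intros)
  obtain u where u: "0 < u" "u < 1" "G 1 - G 0 = (1 - 0) * h u"
    using mvt_of_within_derivative[OF dG, of 0 1] by auto
  then have "G 0 < G 1" using hpos[of u] by simp
  also have "G 1 \<le> 0 - b / 2 * l\<^sup>2"
  proof (rule tendsto_lowerbound)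
    show "(G \<longlongrightarrow> 0 - b / 2 * l\<^sup>2) at_top"
      unfolding G_def[abs_def] by (intro tendsto_intros l profile_f1_lim)
    show "\<forall>\<^sub>F t in at_top. G 1 \<le> G t"
      using eventually_gt_at_top[of 1]
    proof (rule eventually_mono)
      fix t :: real assume "1 < t"
      then show "G 1 \<le> G t"
        by (intro nondecreasing_of_within_derivative[OF dG]) (use hpos in \<open>simp_all add: less_imp_le\<close>)
    qed
  qed simp
  finally have "l\<^sup>2 < (f 0)\<^sup>2 + 2 / b"
    using b by (simp add: G_def profile_f1_0 field_simps)
  then have "sqrt (l\<^sup>2) < sqrt ((f 0)\<^sup>2 + 2 / b)" by (rule real_sqrt_less_mono)
  then show "- sqrt ((f 0)\<^sup>2 + 2 / b) < l" by simp
qed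

end

subsection \<open>Uniqueness\<close>

text \<open>The time change \<open>\<sigma>\<close> synchronises the two profiles: \<open>g1 (\<sigma> t) = f1 t\<close>. Along it, the two
  differences \<open>f t - g (\<sigma> t)\<close> and \<open>f2 t - g2 (\<sigma> t)\<close> drive each other upwards, so that \<open>f2\<close> stays
  bounded away from \<open>0\<close>.\<close>

lemma profile_initial_curvature_le:
  assumes b: "b > 0" and F: "monotone_profile b f f1 f2" and G: "monotone_profile b g g1 g2"
    and start: "f 0 = g 0"
  shows "f2 0 \<le> g2 0"
proof (rule ccontr)
  assume "\<not> f2 0 \<le> g2 0"
  then have \<delta>: "f2 0 - g2 0 > 0" by simp
  note f = profile_derivs[OF b F] and g = profile_derivs[OF b G]
  note f2pos = profile_f2_pos[OF b F] and g2pos = profile_f2_pos[OF b G]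
  \<comment> \<open>The inverse of \<open>g1\<close>, meaningful only for
    \<open>-1 \<le> v < 0\<close>; all values of \<open>f1\<close> lie in this range.\<close>
  define \<tau> where "\<tau> v = (SOME s. s \<ge> 0 \<and> g1 s = v)" for v
  have \<tau>: "\<tau> v \<ge> 0 \<and> g1 (\<tau> v) = v" if "-1 \<le> v" "v < 0" for v
    unfolding \<tau>_def using profile_f1_attains[OF b G that] by (rule someI_ex)
  have \<tau>g: "\<tau> (g1 s) = s" if s: "s \<ge> 0" for s
  proof -
    have *: "\<tau> (g1 s) \<ge> 0 \<and> g1 (\<tau> (g1 s)) = g1 s"
      using profile_f1_bounds[OF b G s] profile_f1_neg[OF b G s] by (intro \<tau>) simp_all
    then show ?thesis
      using profile_f1_less_iff[OF b G, of s "\<tau> (g1 s)"] profile_f1_less_iff[OF b G, of "\<tau> (g1 s)" s] s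
      by simp
  qed
  define \<sigma> where "\<sigma> t = \<tau> (f1 t)" for t
  have \<sigma>0: "\<sigma> 0 = 0"
    using \<tau>g[of 0] profile_f1_0[OF b F] profile_f1_0[OF b G] by (simp add: \<sigma>_def)
  have \<sigma>nn: "\<sigma> t \<ge> 0" and g\<sigma>: "g1 (\<sigma> t) = f1 t" if "t \<ge> 0" for t
    using \<tau>[of "f1 t"] profile_f1_bounds[OF b F that] profile_f1_neg[OF b F that]
    by (simp_all add: \<sigma>_def)
  have \<sigma>pos: "\<sigma> t > 0" if t: "t > 0" for t
  proof -
    have "g1 0 < g1 (\<sigma> t)"
      using g\<sigma>[of t] t profile_f1_strict_mono[OF b F, of 0 t] profile_f1_0[OF b F] profile_f1_0[OF b G]
      by simp
    then show ?thesis using profile_f1_less_iff[OF b G, of 0 "\<sigma> t"] \<sigma>nn[of t] t by simp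
  qed
  have d\<sigma>: "(\<sigma> has_real_derivative f2 t / g2 (\<sigma> t)) (at t)" if t: "t > 0" for t
  proof -
    have "(\<tau> has_derivative (\<lambda>x. x / g2 (\<sigma> t))) (at (g1 (\<sigma> t)))"
    proof (rule has_derivative_inverse_strong[where S = "{0<..}" and f = g1 and x = "\<sigma> t"
          and f' = "\<lambda>x. g2 (\<sigma> t) * x"])
      show "continuous_on {0<..} g1"
        by (rule continuous_on_of_within_derivative[OF g(2)]) auto
      have "(g1 has_real_derivative g2 (\<sigma> t)) (at (\<sigma> t))"
        using has_real_derivative_at_of_within[OF g(2)[rule_format] \<sigma>pos[OF t]] \<sigma>pos[OF t] by simp
      then show "(g1 has_derivative (\<lambda>x. g2 (\<sigma> t) * x)) (at (\<sigma> t))"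
        by (simp add: has_field_derivative_def)
      show "(\<lambda>x. g2 (\<sigma> t) * x) \<circ> (\<lambda>x. x / g2 (\<sigma> t)) = id"
        using g2pos[of "\<sigma> t"] \<sigma>nn[of t] t by (simp add: fun_eq_iff)
    qed (use \<sigma>pos[OF t] \<tau>g in simp_all)
    moreover have "(\<lambda>x. x / g2 (\<sigma> t)) = (*) (1 / g2 (\<sigma> t))" by (simp add: fun_eq_iff)
    moreover have "g1 (\<sigma> t) = f1 t" using g\<sigma> t by simp
    ultimately have "(\<tau> has_real_derivative 1 / g2 (\<sigma> t)) (at (f1 t))"
      unfolding has_field_derivative_def by simp
    moreover have "(f1 has_real_derivative f2 t) (at t)"
      using has_real_derivative_at_of_within[OF f(2)[rule_format] t] t by simp
    ultimately have "((\<lambda>s. \<tau> (f1 s)) has_real_derivative 1 / g2 (\<sigma> t) * f2 t) (at t)"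
      by (rule DERIV_chain2)
    then show ?thesis by (simp add: \<sigma>_def[abs_def])
  qed
  \<comment> \<open>The inverse function theorem gives the derivative of \<open>\<sigma>\<close>
    only at positive times. At \<open>0\<close>, continuity comes from monotonicity:
    \<open>\<sigma> t < e\<close> as soon as \<open>f1 t < g1 e\<close>.\<close>
  have c\<sigma>: "continuous_on {0..} \<sigma>"
    unfolding continuous_on_eq_continuous_within
  proof
    fix t :: real assume "t \<in> {0..}"
    then have "t \<ge> 0" by simp
    then consider "t = 0" | "t > 0" by linarith
    then show "continuous (at t within {0..}) \<sigma>"
    proof cases
      case 2
      then show ?thesis
        by (rule continuous_at_imp_continuous_at_within[OF DERIV_isCont[OF d\<sigma>]])
    next
      case 1
      have "(\<sigma> \<longlongrightarrow> 0) (at_right 0)"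
      proof (rule order_tendstoI)
        fix e :: real assume "e < 0"
        show "\<forall>\<^sub>F t in at_right 0. e < \<sigma> t"
          using eventually_at_right_less[of 0]
        proof (rule eventually_mono)
          fix t :: real assume "0 < t"
          then show "e < \<sigma> t" using \<sigma>nn[of t] \<open>e < 0\<close> by simp
        qed
      next
        fix e :: real assume e: "0 < e"
        have "(f1 \<longlongrightarrow> -1) (at_right 0)"
          using DERIV_continuous[OF f(2)[rule_format, of 0]]
          by (simp add: continuous_within at_within_Ici_at_right profile_f1_0[OF b F])
        moreover have "-1 < g1 e"
          using profile_f1_strict_mono[OF b G, of 0 e] e profile_f1_0[OF b G] by simp
        ultimately have "\<forall>\<^sub>F t in at_right 0. f1 t < g1 e" by (rule order_tendstoD)
        then show "\<forall>\<^sub>F t in at_right 0. \<sigma> t < e"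
          using eventually_at_right_less[of 0]
        proof eventually_elim
          case (elim t)
          then show ?case
            using profile_f1_less_iff[OF b G \<sigma>nn[of t], of e] g\<sigma>[of t] e by simp
        qed
      qed
      then show ?thesis unfolding 1 by (simp add: continuous_within at_within_Ici_at_right \<sigma>0)
    qed
  qed
  define D where "D t = f2 t - g2 (\<sigma> t)" for t
  define D' where "D' t = (b * f t * f2 t - (1 + 2 * b) * (f1 t)\<^sup>2)
      - (b * g (\<sigma> t) * g2 (\<sigma> t) - (1 + 2 * b) * (g1 (\<sigma> t))\<^sup>2) * (f2 t / g2 (\<sigma> t))" for t
  define W where "W t = f t - g (\<sigma> t)" for t
  define W' where "W' t = f1 t - g1 (\<sigma> t) * (f2 t / g2 (\<sigma> t))" for t
  have dD: "(D has_real_derivative D' t) (at t)" and dW: "(W has_real_derivative W' t) (at t)"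
    if t: "t > 0" for t
  proof -
    have "(g2 has_real_derivative b * g (\<sigma> t) * g2 (\<sigma> t) - (1 + 2 * b) * (g1 (\<sigma> t))\<^sup>2) (at (\<sigma> t))"
      using has_real_derivative_at_of_within[OF g(3)[rule_format] \<sigma>pos[OF t]] \<sigma>pos[OF t] by simp
    note 1 = DERIV_chain2[OF this d\<sigma>[OF t]]
    have "(f2 has_real_derivative b * f t * f2 t - (1 + 2 * b) * (f1 t)\<^sup>2) (at t)"
      using has_real_derivative_at_of_within[OF f(3)[rule_format] t] t by simp
    then show "(D has_real_derivative D' t) (at t)"
      unfolding D_def[abs_def] D'_def by (rule DERIV_diff[OF _ 1])
    have "(g has_real_derivative g1 (\<sigma> t)) (at (\<sigma> t))"
      using has_real_derivative_at_of_within[OF g(1)[rule_format] \<sigma>pos[OF t]] \<sigma>pos[OF t] by simp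
    note 2 = DERIV_chain2[OF this d\<sigma>[OF t]]
    have "(f has_real_derivative f1 t) (at t)"
      using has_real_derivative_at_of_within[OF f(1)[rule_format] t] t by simp
    then show "(W has_real_derivative W' t) (at t)"
      unfolding W_def[abs_def] W'_def by (rule DERIV_diff[OF _ 2])
  qed
  have c\<sigma>u: "continuous_on {0..u} \<sigma>" for u
    by (rule continuous_on_subset[OF c\<sigma>]) simp
  have \<sigma>im: "\<sigma> ` {0..u} \<subseteq> {0..}" for u
  proof
    fix v assume "v \<in> \<sigma> ` {0..u}"
    then obtain s where "s \<in> {0..u}" "v = \<sigma> s" by (rule imageE)
    then show "v \<in> {0..}" using \<sigma>nn[of s] by simp
  qed
  have cD: "continuous_on {0..u} D" for u
  proof -
    have "continuous_on {0..u} f2" by (rule continuous_on_of_within_derivative[OF f(3)]) simp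
    moreover have "continuous_on {0..} g2" by (rule continuous_on_of_within_derivative[OF g(3)]) simp
    then have "continuous_on {0..u} (\<lambda>t. g2 (\<sigma> t))" by (rule continuous_on_compose2[OF _ c\<sigma>u \<sigma>im])
    ultimately show ?thesis unfolding D_def[abs_def] by (rule continuous_on_diff)
  qed
  have cW: "continuous_on {0..u} W" for u
  proof -
    have "continuous_on {0..u} f" by (rule continuous_on_of_within_derivative[OF f(1)]) simp
    moreover have "continuous_on {0..} g" by (rule continuous_on_of_within_derivative[OF g(1)]) simp
    then have "continuous_on {0..u} (\<lambda>t. g (\<sigma> t))" by (rule continuous_on_compose2[OF _ c\<sigma>u \<sigma>im])
    ultimately show ?thesis unfolding W_def[abs_def] by (rule continuous_on_diff)
  qed
  have Dge: "D t \<ge> D 0" if t: "t \<ge> 0" for t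
  proof -
    \<comment> \<open>The barrier with rate \<open>0\<close>. Its hypothesis on the whole past is
      essential: \<open>W u \<ge> 0\<close> is obtained by integrating the sign of \<open>D\<close>
      from \<open>0\<close> to \<open>u\<close>.\<close>
    have "D t \<ge> D 0 * exp (- 0 * (t - 0))"
    proof (rule positivity_barrier[OF t cD])
      fix u assume u: "0 < u" "u < t"
      show "(D has_real_derivative D' u) (at u)" by (rule dD[OF u(1)])
      assume nn: "\<And>w. 0 \<le> w \<Longrightarrow> w \<le> u \<Longrightarrow> D w \<ge> 0"
      have "W 0 \<le> W u"
      proof (rule DERIV_nonneg_imp_increasing_open[OF less_imp_le[OF u(1)] _ cW])
        fix w assume w: "0 < w" "w < u"
        have gp: "g2 (\<sigma> w) > 0" using g2pos \<sigma>nn w by simp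
        have "W' w = (- f1 w) * (D w / g2 (\<sigma> w))"
        proof -
          have 1: "g1 (\<sigma> w) = f1 w" using g\<sigma> w by simp
          have 2: "D w / g2 (\<sigma> w) = f2 w / g2 (\<sigma> w) - 1"
            using gp by (simp add: D_def diff_divide_distrib)
          show ?thesis unfolding W'_def 1 2 by (simp add: right_diff_distrib)
        qed
        also have "\<dots> \<ge> 0"
          using profile_f1_bounds[OF b F, of w] nn[of w] gp w by (intro mult_nonneg_nonneg divide_nonneg_pos) simp_all
        finally show "\<exists>y. (W has_real_derivative y) (at w) \<and> 0 \<le> y"
          by (intro exI[of _ "W' w"] conjI dW[OF w(1)])
      qed
      then have Wu: "W u \<ge> 0" using start \<sigma>0 by (simp add: W_def)
      have gp: "g2 (\<sigma> u) > 0" using g2pos \<sigma>nn u by simp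
      have fp: "f2 u > 0" using f2pos u by simp
      have "D' u = b * f2 u * W u + (1 + 2 * b) * (f1 u)\<^sup>2 * (D u / g2 (\<sigma> u))"
      proof -
        have 1: "g1 (\<sigma> u) = f1 u" using g\<sigma> u by simp
        have 2: "D u / g2 (\<sigma> u) = f2 u / g2 (\<sigma> u) - 1"
          using gp by (simp add: D_def diff_divide_distrib)
        have 3: "b * g (\<sigma> u) * g2 (\<sigma> u) * (f2 u / g2 (\<sigma> u)) = b * g (\<sigma> u) * f2 u"
          using gp by simp
        show ?thesis
          unfolding D'_def W_def 1 2 left_diff_distrib[of _ _ "f2 u / g2 (\<sigma> u)"] 3
          by (simp add: right_diff_distrib mult_ac)
      qed
      also have "\<dots> \<ge> 0"
        using b fp Wu nn[of u] gp u
        by (intro add_nonneg_nonneg mult_nonneg_nonneg divide_nonneg_pos) simp_all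
      finally show "- 0 * D u \<le> D' u" by simp
    next
      show "D 0 > 0" using \<delta> \<sigma>0 by (simp add: D_def)
    qed
    then show ?thesis by simp
  qed
  have big: "f2 t \<ge> D 0" if "t \<ge> 0" for t
    using Dge[OF that] g2pos[OF \<sigma>nn[OF that]] by (simp add: D_def)
  have D0: "D 0 > 0" using \<delta> \<sigma>0 by (simp add: D_def)
  \<comment> \<open>With slope at least \<open>D 0\<close>, \<open>f1\<close> would climb from
    \<open>-1\<close> to a nonnegative value within this time.\<close>
  define T where "T = 1 / D 0"
  have T: "T > 0" using D0 by (simp add: T_def)
  obtain u where u: "0 < u" "u < T" "f1 T - f1 0 = (T - 0) * f2 u"
    by (rule mvt_of_within_derivative[OF f(2) order_refl T])
  have "T * D 0 \<le> T * f2 u" using big[of u] u T by (intro mult_left_mono) simp_all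
  moreover have "T * D 0 = 1" using D0 by (simp add: T_def)
  ultimately have "f1 T \<ge> 0" using u(3) unfolding profile_f1_0[OF b F] by simp
  then show False using profile_f1_neg[OF b F, of T] T by simp
qed

section \<open>From equal initial data to equal profiles\<close>

lemma gronwall_zero:
  fixes u :: "real \<Rightarrow> real"
  assumes du: "\<forall>t\<ge>0. (u has_real_derivative u' t) (at t within {0..})"
    and le: "\<And>t. 0 < t \<Longrightarrow> t < T \<Longrightarrow> u' t \<le> K * u t"
    and u0: "u 0 = 0" and T: "T \<ge> 0"
  shows "u T \<le> 0"
proof -
  define h where "h t = - (exp (- K * t) * u t)" for t
  have "\<forall>t\<ge>0. (h has_real_derivative exp (- K * t) * (K * u t - u' t)) (at t within {0..})"
  proof (intro allI impI)
    fix t :: real assume "t \<ge> 0"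
    then have "(u has_real_derivative u' t) (at t within {0..})" using du by simp
    then show "(h has_real_derivative exp (- K * t) * (K * u t - u' t)) (at t within {0..})"
      unfolding h_def[abs_def] by (auto intro!: derivative_eq_intros simp: algebra_simps)
  qed
  then have "h 0 \<le> h T"
    by (rule nondecreasing_of_within_derivative) (use le T in simp_all)
  then show ?thesis using u0 by (simp add: h_def mult_le_0_iff)
qed

lemma profile_unique:
  assumes b: "b > 0" and F: "monotone_profile b f f1 f2" and G: "monotone_profile b g g1 g2"
    and start: "f 0 = g 0" and T: "T \<ge> 0"
  shows "f T = g T"
proof -
  note f = profile_derivs[OF b F] and g = profile_derivs[OF b G]
  have start2: "f2 0 = g2 0"
    using profile_initial_curvature_le[OF b F G start] profile_initial_curvature_le[OF b G F start[symmetric]]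
    by simp
  \<comment> \<open>The nonlinearities are split as \<open>f * f2 - g * g2 = f2 * p + g * r\<close>
    and \<open>f1^2 - g1^2 = (f1 + g1) * q\<close>, hence bounds for \<open>f2\<close> of one
    profile and for \<open>g\<close> of the other.\<close>
  obtain Mf where Mf: "Mf \<ge> 0" "\<And>t. 0 \<le> t \<Longrightarrow> t \<le> T \<Longrightarrow> \<bar>f2 t\<bar> \<le> Mf"
    using bounded_on_Icc_of_within_derivative[OF f(3), of T] by metis
  obtain Mg where Mg: "Mg \<ge> 0" "\<And>t. 0 \<le> t \<Longrightarrow> t \<le> T \<Longrightarrow> \<bar>g t\<bar> \<le> Mg"
    using bounded_on_Icc_of_within_derivative[OF g(1), of T] by metis
  define p q r where "p t = f t - g t" and "q t = f1 t - g1 t" and "r t = f2 t - g2 t" for t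
  define u where "u t = (p t)\<^sup>2 + (q t)\<^sup>2 + (r t)\<^sup>2" for t
  define u' where "u' t = 2 * p t * q t + 2 * q t * r t + 2 * r t * ((b * f t * f2 t - (1 + 2 * b) * (f1 t)\<^sup>2)
      - (b * g t * g2 t - (1 + 2 * b) * (g1 t)\<^sup>2))" for t
  define K where "K = 2 + b * Mf + 2 * b * Mg + 2 * (1 + 2 * b)"
  have "u T \<le> 0"
  proof (rule gronwall_zero[OF _ _ _ T])
    show "\<forall>t\<ge>0. (u has_real_derivative u' t) (at t within {0..})"
    proof (intro allI impI)
      fix t :: real assume t: "t \<ge> 0"
      have "(p has_real_derivative q t) (at t within {0..})"
        unfolding p_def[abs_def] q_def using f(1) g(1) t by (intro DERIV_diff) simp_all
      moreover have "(q has_real_derivative r t) (at t within {0..})"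
        unfolding q_def[abs_def] r_def using f(2) g(2) t by (intro DERIV_diff) simp_all
      moreover have "(r has_real_derivative (b * f t * f2 t - (1 + 2 * b) * (f1 t)\<^sup>2)
          - (b * g t * g2 t - (1 + 2 * b) * (g1 t)\<^sup>2)) (at t within {0..})"
        unfolding r_def[abs_def] using f(3) g(3) t by (intro DERIV_diff) simp_all
      ultimately show "(u has_real_derivative u' t) (at t within {0..})"
        unfolding u_def[abs_def] u'_def by (auto intro!: derivative_eq_intros)
    qed
    show "u 0 = 0"
      using start start2 profile_f1_0[OF b F] profile_f1_0[OF b G] by (simp add: u_def p_def q_def r_def)
    fix t assume t: "0 < t" "t < T"
    have prod: "2 * x * y * c \<le> C * u t"
      if "x\<^sup>2 + y\<^sup>2 \<le> u t" "\<bar>c\<bar> \<le> C" for x y c C :: real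
    proof -
      have "2 * x * y * c \<le> \<bar>2 * x * y\<bar> * \<bar>c\<bar>" using abs_ge_self[of "2 * x * y * c"] unfolding abs_mult by simp
      also have "\<bar>2 * x * y\<bar> \<le> x\<^sup>2 + y\<^sup>2"
        using zero_le_power2[of "x + y"] zero_le_power2[of "x - y"] by (simp add: power2_sum power2_diff abs_le_iff)
      then have "\<bar>2 * x * y\<bar> * \<bar>c\<bar> \<le> u t * C"
        using that by (intro mult_mono) (simp_all add: u_def)
      finally show ?thesis by (simp add: mult.commute)
    qed
    have "2 * p t * q t * 1 \<le> 1 * u t" by (rule prod) (simp_all add: u_def)
    moreover have "2 * q t * r t * 1 \<le> 1 * u t" by (rule prod) (simp_all add: u_def)
    moreover have "2 * r t * p t * (b * f2 t) \<le> (b * Mf) * u t"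
      using b Mf(2)[of t] t by (intro prod) (simp_all add: u_def abs_mult)
    moreover have "b * g t * (r t)\<^sup>2 \<le> b * Mg * u t"
    proof (rule mult_mono)
      show "b * g t \<le> b * Mg" using b Mg(2)[of t] t by simp
    qed (use b Mg in \<open>simp_all add: u_def\<close>)
    moreover have "2 * r t * q t * (- (1 + 2 * b) * (f1 t + g1 t)) \<le> ((1 + 2 * b) * 2) * u t"
    proof (rule prod)
      have "\<bar>f1 t + g1 t\<bar> \<le> 2"
        using profile_f1_bounds[OF b F, of t] profile_f1_bounds[OF b G, of t] t by simp
      then have "(1 + 2 * b) * \<bar>f1 t + g1 t\<bar> \<le> (1 + 2 * b) * 2" using b by (intro mult_left_mono) simp_all
      moreover have "\<bar>- (1 + 2 * b) * (f1 t + g1 t)\<bar> = (1 + 2 * b) * \<bar>f1 t + g1 t\<bar>"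
        unfolding abs_mult using b by simp
      ultimately show "\<bar>- (1 + 2 * b) * (f1 t + g1 t)\<bar> \<le> (1 + 2 * b) * 2" by simp
    qed (simp add: u_def)
    moreover have "u' t = 2 * p t * q t * 1 + 2 * q t * r t * 1 + 2 * r t * p t * (b * f2 t)
        + 2 * (b * g t * (r t)\<^sup>2) + 2 * r t * q t * (- (1 + 2 * b) * (f1 t + g1 t))"
      unfolding u'_def p_def q_def r_def by (simp add: power2_eq_square algebra_simps)
    moreover have "K * u t = 1 * u t + 1 * u t + (b * Mf) * u t + 2 * (b * Mg * u t) + ((1 + 2 * b) * 2) * u t"
      unfolding K_def by (simp add: algebra_simps)
    ultimately show "u' t \<le> K * u t" by linarith
  qed
  then have "(p T)\<^sup>2 \<le> 0"
    using zero_le_power2[of "q T"] zero_le_power2[of "r T"] unfolding u_def by linarith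
  then show ?thesis by (simp add: p_def)
qed

section \<open>Translation to the boundary value problem and conclusion\<close>

lemma convex_bvp_solution_iff_profile:
  fixes b :: real
  assumes m: "m = - 1 - 2 * b"
  shows "convex_bvp_solution m a f \<longleftrightarrow> f 0 = a \<and> (\<exists>f1 f2. monotone_profile b f f1 f2)"
proof
  assume "convex_bvp_solution m a f"
  then have conv: "convex_on {0..} f" and "bvp_solution m a f"
    unfolding convex_bvp_solution_def by blast+
  then obtain f1 f2 f3 where
    d: "\<forall>t\<ge>0. (f has_real_derivative f1 t) (at t within {0..})"
      "\<forall>t\<ge>0. (f1 has_real_derivative f2 t) (at t within {0..})"
      "\<forall>t\<ge>0. (f2 has_real_derivative f3 t) (at t within {0..})"
    and eq: "\<forall>t\<ge>0. f3 t + (m + 1) / 2 * f t * f2 t - m * (f1 t)\<^sup>2 = 0"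
    and i: "f 0 = a" "f1 0 = -1" "(f1 \<longlongrightarrow> 0) at_top"
    unfolding bvp_solution_def by blast
  have "f3 t = b * f t * f2 t - (1 + 2 * b) * (f1 t)\<^sup>2" if "t \<ge> 0" for t
  proof -
    have "f3 t + (m + 1) / 2 * f t * f2 t - m * (f1 t)\<^sup>2 = 0" using eq that by blast
    then show ?thesis by (simp add: m algebra_simps)
  qed
  then have "\<forall>t\<ge>0. (f2 has_real_derivative b * f t * f2 t - (1 + 2 * b) * (f1 t)\<^sup>2) (at t within {0..})"
    using d(3) by simp
  moreover have "\<forall>t\<ge>0. f2 t \<ge> 0"
    by (rule convex_on_imp_second_derivative_nonneg[OF d conv])
  ultimately have "monotone_profile b f f1 f2"
    unfolding monotone_profile_def using d(1,2) i(2,3) by blast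
  then show "f 0 = a \<and> (\<exists>f1 f2. monotone_profile b f f1 f2)" using i(1) by blast
next
  assume "f 0 = a \<and> (\<exists>f1 f2. monotone_profile b f f1 f2)"
  then obtain f1 f2 where a: "f 0 = a" and
    d: "\<forall>t\<ge>0. (f has_real_derivative f1 t) (at t within {0..})"
      "\<forall>t\<ge>0. (f1 has_real_derivative f2 t) (at t within {0..})"
      "\<forall>t\<ge>0. (f2 has_real_derivative b * f t * f2 t - (1 + 2 * b) * (f1 t)\<^sup>2) (at t within {0..})"
    and i: "f1 0 = -1" "(f1 \<longlongrightarrow> 0) at_top" "\<forall>t\<ge>0. f2 t \<ge> 0"
    unfolding monotone_profile_def by blast
  have "\<forall>t\<ge>0. b * f t * f2 t - (1 + 2 * b) * (f1 t)\<^sup>2 + (m + 1) / 2 * f t * f2 t - m * (f1 t)\<^sup>2 = 0"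
    by (simp add: m algebra_simps)
  then have "bvp_solution m a f"
    unfolding bvp_solution_def
    by (intro exI[of _ f1] exI[of _ f2] exI[of _ "\<lambda>t. b * f t * f2 t - (1 + 2 * b) * (f1 t)\<^sup>2"] conjI d a i)
  moreover have "convex_on {0..} f"
    by (rule convex_on_of_within_derivative_mono[OF d(1,2) i(3)])
  ultimately show "convex_bvp_solution m a f" unfolding convex_bvp_solution_def by blast
qed

theorem theorem1:
  fixes m a :: real
  assumes "m < -1"
  shows "\<exists>f. convex_bvp_solution m a f \<and>
           (\<forall>g. convex_bvp_solution m a g \<longrightarrow> (\<forall>t\<ge>0. g t = f t)) \<and>
           bounded (f ` {0..}) \<and>
           (\<forall>l. (f \<longlongrightarrow> l) at_top \<longrightarrow> - sqrt (a\<^sup>2 - 4 / (m + 1)) < l \<and> l < a)"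
proof -
  define b where "b = - (m + 1) / 2"
  have b: "b > 0" using assms by (simp add: b_def)
  have m: "m = - 1 - 2 * b" by (simp add: b_def field_simps)
  have four: "a\<^sup>2 - 4 / (m + 1) = a\<^sup>2 + 2 / b"
    unfolding m using b by (simp add: field_simps)
  note iff = convex_bvp_solution_iff_profile[OF m, of a]
  obtain f f1 f2 M where
    d: "\<forall>t\<ge>0. (f has_real_derivative f1 t) (at t within {0..})"
      "\<forall>t\<ge>0. (f1 has_real_derivative f2 t) (at t within {0..})"
      "\<forall>t\<ge>0. (f2 has_real_derivative b * f t * f2 t - (1 + 2 * b) * (f1 t)\<^sup>2) (at t within {0..})"
    and f0: "f 0 = a" and i: "f1 0 = -1" "(f1 \<longlongrightarrow> 0) at_top" "\<forall>t\<ge>0. f2 t \<ge> 0"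
    and bd: "\<forall>t\<ge>0. \<bar>f t\<bar> \<le> M"
    by (rule ex_monotone_profile[OF b, of a])
  have prof: "monotone_profile b f f1 f2"
    unfolding monotone_profile_def using d i by blast
  show ?thesis
  proof (intro exI[of _ f] conjI allI impI)
    show "convex_bvp_solution m a f" unfolding iff using prof f0 by blast
    show "bounded (f ` {0..})" using bd by (intro boundedI[of _ M]) auto
    fix g and t :: real assume "convex_bvp_solution m a g" and t: "0 \<le> t"
    then obtain g1 g2 where "g 0 = a" "monotone_profile b g g1 g2" unfolding iff by blast
    then show "g t = f t" using profile_unique[OF b _ prof _ t, of g g1 g2] f0 by simp
  next
    fix l assume "(f \<longlongrightarrow> l) at_top"
    from profile_limit_bounds[OF b prof this]
    show "- sqrt (a\<^sup>2 - 4 / (m + 1)) < l" "l < a" unfolding f0 four by blast+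
  qed
qed

end
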